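(* The class of semistrong-P-rankable sets is closed under complementation if and only if it is closed under join.
   Context: $\Sigma=\{0,1\}$; strings are ordered in length-lexicographic order, and natural numbers are identified with strings in the standard way. For $A\subseteq\Sigma^*$, $\mathrm{rank}_A(y)=\|\{z\mid z\le y \wedge z\in A\}\|$. $A$ is semistrong-P-rankable if there is a total polynomial-time computable $f$ such that $f(x)=\mathrm{rank}_A(x)$ for $x\in A$ and $f(x)$ outputs a special indication ``not in set'' for $x\notin A$. The join is $A\oplus B=\{x0\mid x\in A\}\cup\{x1\mid x\in B\}$; closure under join means $A,B$ in the class implies $A\oplus B$ in the class, and closure under complementation means $A$ in the class implies $\Sigma^*-A$ in the class. *)

theory Defs
  imports "HOL-Computational_Algebra.Polynomial"
begin

section \<open>Strings, length-lexicographic order, and numbers\<close>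

type_synonym str = "bool list"

definition llex_less :: "str \<Rightarrow> str \<Rightarrow> bool" where
  "llex_less u v \<longleftrightarrow> (u, v) \<in> lenlex {(False, True)}"

definition llex_le :: "str \<Rightarrow> str \<Rightarrow> bool" where
  "llex_le u v \<longleftrightarrow> u = v \<or> llex_less u v"

text \<open>
  The standard identification of strings with natural numbers sends a string to its position
  in length-lexicographic order: the empty string is 0, then 0, 1, 00, 01, ... are 1, 2, 3, 4, ...
\<close>

definition nat_of_str :: "str \<Rightarrow> nat" where
  "nat_of_str w = card {z. llex_less z w}"

definition str_of_nat :: "nat \<Rightarrow> str" where
  "str_of_nat = inv nat_of_str"

definition rank :: "str set \<Rightarrow> str \<Rightarrow> nat" where
  "rank A y = card {z. llex_le z y \<and> z \<in> A}"


section \<open>Deterministic multitape Turing machines\<close>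

text \<open>
  \<open>Aux i\<close> are auxiliary work symbols; every machine uses only finitely many of them.
  \<open>NotInSet\<close> is the special indication that may be output instead of a string.
\<close>

datatype sym = Blank | Bit bool | NotInSet | Aux nat

datatype direction = Left | Stay | Right

text \<open>
  Tapes are infinite in both directions: a tape is its contents together with the head position.
  The nonhalting states are the numbers below \<open>num_states\<close>, the start state is 0 (which is
  also the halting state if \<open>num_states = 0\<close>), and the halting state is \<open>num_states\<close>.
  In one step the machine reads one symbol from each tape and, on each tape, writes a symbol and
  then moves the head.
\<close>

type_synonym tape = "(int \<Rightarrow> sym) \<times> int"

type_synonym config = "nat \<times> tape list"

record tm =
  num_tapes :: nat
  num_states :: nat
  alphabet :: "sym set"
  delta :: "nat \<Rightarrow> sym list \<Rightarrow> nat \<times> (sym \<times> direction) list"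

definition wf_tm :: "tm \<Rightarrow> bool" where
  "wf_tm M \<longleftrightarrow>
     num_tapes M \<ge> 2 \<and>
     finite (alphabet M) \<and>
     {Blank, Bit False, Bit True, NotInSet} \<subseteq> alphabet M \<and>
     (\<forall>q ss. q < num_states M \<and> length ss = num_tapes M \<and> set ss \<subseteq> alphabet M \<longrightarrow>
        (case delta M q ss of (q', acts) \<Rightarrow>
           q' \<le> num_states M \<and> length acts = num_tapes M \<and> fst ` set acts \<subseteq> alphabet M))"

fun offset :: "direction \<Rightarrow> int" where
  "offset Left = - 1"
| "offset Stay = 0"
| "offset Right = 1"

fun read_tape :: "tape \<Rightarrow> sym" where
  "read_tape (t, h) = t h"

fun act_tape :: "tape \<Rightarrow> sym \<times> direction \<Rightarrow> tape" where
  "act_tape (t, h) (s, d) = (t(h := s), h + offset d)"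

definition halted :: "tm \<Rightarrow> config \<Rightarrow> bool" where
  "halted M c \<longleftrightarrow> fst c = num_states M"

definition step :: "tm \<Rightarrow> config \<Rightarrow> config" where
  "step M c =
     (if halted M c then c
      else case c of (q, ts) \<Rightarrow>
        (case delta M q (map read_tape ts) of (q', acts) \<Rightarrow> (q', map2 act_tape ts acts)))"

definition contents_of :: "sym list \<Rightarrow> int \<Rightarrow> sym" where
  "contents_of w i = (if 0 \<le> i \<and> i < int (length w) then w ! nat i else Blank)"

text \<open>Tape 0 initially holds the input, tape 1 finally holds the output.\<close>

definition init_config :: "tm \<Rightarrow> str \<Rightarrow> config" where
  "init_config M x =
     (0, (contents_of (map Bit x), 0) # replicate (num_tapes M - 1) (contents_of [], 0))"

definition computes_within :: "tm \<Rightarrow> (str \<Rightarrow> sym list) \<Rightarrow> (nat \<Rightarrow> nat) \<Rightarrow> bool" where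
  "computes_within M f T \<longleftrightarrow>
     (\<forall>x. \<exists>t \<le> T (length x).
        let c = (step M ^^ t) (init_config M x)
        in halted M c \<and> fst (snd c ! 1) = contents_of (f x))"

definition polytime_computable :: "(str \<Rightarrow> sym list) \<Rightarrow> bool" where
  "polytime_computable f \<longleftrightarrow> (\<exists>M (p :: nat poly). wf_tm M \<and> computes_within M f (poly p))"


section \<open>Semistrong-P-rankable sets and closure properties\<close>

text \<open>An answer is either a number, output as the corresponding string, or the special indication.\<close>

fun encode_answer :: "nat option \<Rightarrow> sym list" where
  "encode_answer None = [NotInSet]"
| "encode_answer (Some n) = map Bit (str_of_nat n)"

definition semistrong_P_rankable :: "str set \<Rightarrow> bool" where
  "semistrong_P_rankable A \<longleftrightarrow>
     (\<exists>f :: str \<Rightarrow> nat option.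
        polytime_computable (\<lambda>x. encode_answer (f x)) \<and>
        (\<forall>x. x \<in> A \<longrightarrow> f x = Some (rank A x)) \<and>
        (\<forall>x. x \<notin> A \<longrightarrow> f x = None))"

text \<open>The marking bit is appended at the end of the string.\<close>

definition join :: "str set \<Rightarrow> str set \<Rightarrow> str set" where
  "join A B = {x @ [False] | x. x \<in> A} \<union> {x @ [True] | x. x \<in> B}"

definition closed_under_join :: "str set set \<Rightarrow> bool" where
  "closed_under_join \<C> \<longleftrightarrow> (\<forall>A \<in> \<C>. \<forall>B \<in> \<C>. join A B \<in> \<C>)"

definition closed_under_complementation :: "str set set \<Rightarrow> bool" where
  "closed_under_complementation \<C> \<longleftrightarrow> (\<forall>A \<in> \<C>. - A \<in> \<C>)"


section \<open>The identification of strings with numbers\<close>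

definition dyadic :: "str \<Rightarrow> nat" where
  "dyadic w = foldl (\<lambda>n b. 2 * n + (if b then 2 else 1)) 0 w"

lemma dyadic_Nil [simp]: "dyadic [] = 0"
  by (simp add: dyadic_def)

lemma dyadic_snoc [simp]: "dyadic (w @ [b]) = 2 * dyadic w + (if b then 2 else 1)"
  by (simp add: dyadic_def)

lemma dyadic_Cons: "dyadic (b # w) = (if b then 2 else 1) * 2 ^ length w + dyadic w"
  by (induction w rule: rev_induct) (simp_all add: dyadic_def algebra_simps)

lemma dyadic_bounds: "2 ^ length w \<le> dyadic w + 1 \<and> dyadic w + 2 \<le> 2 * 2 ^ length w"
  by (induction w rule: rev_induct) auto

lemma dyadic_mono: "llex_less u v \<Longrightarrow> dyadic u < dyadic v"
proof -
  have *: "dyadic u < dyadic v" if "length u < length v" for u v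
  proof -
    have "(2::nat) * 2 ^ length u \<le> 2 ^ length v"
      using that by (metis Suc_leI power_Suc power_increasing one_le_numeral)
    then show ?thesis
      using dyadic_bounds[of u] dyadic_bounds[of v] by linarith
  qed
  assume "llex_less u v"
  then show ?thesis
    unfolding llex_less_def
  proof (induction u arbitrary: v)
    case Nil
    then show ?case using *[of "[]" v] by simp
  next
    case (Cons a u)
    then obtain b v' where v: "v = b # v'"
      by (cases v) auto
    consider "length u < length v'" | "length u = length v'" "\<not> a" "b"
      | "a = b" "length u = length v'" "(u, v') \<in> lenlex {(False, True)}"
      using Cons.prems lenlex_length[of u v'] unfolding v Cons_lenlex_iff
      by (auto simp: le_less)
    then show ?case
    proof cases
      case 1
      then show ?thesis by (intro *) (simp add: v)
    next
      case 2
      then show ?thesis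
        using dyadic_bounds[of u] dyadic_bounds[of v'] by (simp add: v dyadic_Cons)
    next
      case 3
      then show ?thesis
        using Cons.IH[of v'] by (simp add: v dyadic_Cons)
    qed
  qed
qed

lemma llex_less_total: "u \<noteq> v \<Longrightarrow> llex_less u v \<or> llex_less v u"
proof -
  have "total (lenlex {(False, True)})"
    by (rule total_lenlex) (auto simp: total_on_def)
  then show "u \<noteq> v \<Longrightarrow> ?thesis"
    by (auto simp: total_on_def llex_less_def)
qed

lemma llex_less_iff_dyadic: "llex_less u v \<longleftrightarrow> dyadic u < dyadic v"
  by (metis dyadic_mono llex_less_total less_asym less_irrefl)

lemma bij_dyadic: "bij dyadic"
proof (rule bijI)
  show "inj dyadic"
    by (rule injI) (metis dyadic_mono llex_less_total less_irrefl)
  have "\<exists>w. dyadic w = n" for n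
  proof (induction n rule: less_induct)
    case (less n)
    show ?case
    proof (cases "n = 0")
      case True
      then show ?thesis by (intro exI[of _ "[]"]) simp
    next
      case False
      then obtain m where "m < n" "n = 2 * m + 1 \<or> n = 2 * m + 2"
        using that[of "(n - 1) div 2"] by linarith
      with less show ?thesis
        by (metis dyadic_snoc)
    qed
  qed
  then show "surj dyadic"
    unfolding surj_def by metis
qed

lemma nat_of_str_eq_dyadic: "nat_of_str w = dyadic w"
proof -
  have "dyadic ` {z. dyadic z < dyadic w} = {..<dyadic w}"
  proof (intro equalityI subsetI)
    fix n assume n: "n \<in> {..<dyadic w}"
    obtain z where "n = dyadic z"
      using bij_is_surj[OF bij_dyadic] by (metis surjD)
    with n show "n \<in> dyadic ` {z. dyadic z < dyadic w}" by simp
  qed auto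
  then have "bij_betw dyadic {z. dyadic z < dyadic w} {..<dyadic w}"
    using bij_is_inj[OF bij_dyadic] by (simp add: bij_betw_def inj_on_subset[OF _ subset_UNIV])
  then show ?thesis
    by (simp add: nat_of_str_def llex_less_iff_dyadic bij_betw_same_card)
qed

lemma bij_nat_of_str: "bij nat_of_str"
proof -
  have "nat_of_str = dyadic"
    by (rule ext) (rule nat_of_str_eq_dyadic)
  then show ?thesis
    using bij_dyadic by simp
qed

end

theory Submission
  imports Defs "HOL-Library.Countable"
begin

text \<open>
  If \<open>A\<close>, \<open>B\<close> and their complements are rankable, then the rank of \<open>A\<close> can be computed at all
  strings, because the ranks of \<open>A\<close> and \<open>- A\<close> at \<open>x\<close> add up to the number of strings up to \<open>x\<close>;
  and ranks in \<open>join A B\<close> are sums of ranks in \<open>A\<close> and \<open>B\<close>. Conversely, if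
  \<open>J = join A UNIV\<close> is rankable, then \<open>x @ [True]\<close> always belongs to \<open>J\<close>, and its rank reveals
  the rank of \<open>A\<close> at \<open>x\<close> even for \<open>x \<notin> A\<close>. In both cases the answer is a linear combination of
  answers of given machines, with coefficients chosen by looking at which of these answers are
  \<open>NotInSet\<close>; one machine runs them all and adds up serially.
\<close>

section \<open>Programs on infinitely many tapes\<close>

text \<open>Addition needs only finitely many states. The coefficients come from a finite set, so
  the carry stays bounded and fits into the state together with the chosen coefficients. Halving
  with rounding down keeps this true for negative coefficients, so complements need no separate
  subtraction. A string stands for one less than the binary numeral obtained by putting a 1 before
  it; the constants of the linear combinations absorb these shifts by 1, in every summand and in the
  result. Two obstacles shape the machine model. A halted machine leaves its output head at an
  unknown cell, whereas the adder must start at the last symbol of each answer. And a given machine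
  may behave arbitrarily on symbols outside its own alphabet, whereas the combined machine must be
  well formed over the union of all alphabets. Since \<open>rank A z\<close> is at most
  \<open>dyadic z + 1\<close>, an answer is at most one symbol longer than its argument, so the
  passes over the answers are cheap.\<close>

text \<open>
  A program is a number of states (also its exit state; 0 is the start state) and a transition
  function. Tapes are indexed by all natural numbers so that a program can be run next to others
  without any reindexing; \<open>wf_prog K S\<close> confines it to the first \<open>K\<close> tapes.
\<close>

type_synonym store = "nat \<Rightarrow> tape"

type_synonym prog = "nat \<times> (nat \<Rightarrow> (nat \<Rightarrow> sym) \<Rightarrow> nat \<times> (nat \<Rightarrow> sym \<times> direction))"

definition trans :: "prog \<Rightarrow> ((nat \<times> store) \<times> (nat \<times> store)) set" where
  "trans P = {((q, \<sigma>), (q', \<sigma>')). q < fst P \<and>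
     (\<exists>a. snd P q (\<lambda>i. read_tape (\<sigma> i)) = (q', a) \<and> \<sigma>' = (\<lambda>i. act_tape (\<sigma> i) (a i)))}"

definition runs :: "prog \<Rightarrow> store \<Rightarrow> nat \<Rightarrow> store \<Rightarrow> bool" where
  "runs P \<sigma> t \<sigma>' \<longleftrightarrow> ((0, \<sigma>), (fst P, \<sigma>')) \<in> trans P ^^ t"

definition wf_prog :: "nat \<Rightarrow> sym set \<Rightarrow> prog \<Rightarrow> bool" where
  "wf_prog K S P \<longleftrightarrow>
     (\<forall>q r q' a. q < fst P \<longrightarrow> (\<forall>i. r i \<in> S) \<longrightarrow> snd P q r = (q', a) \<longrightarrow>
        q' \<le> fst P \<and> (\<forall>i. fst (a i) \<in> S) \<and> (\<forall>i\<ge>K. a i = (r i, Stay)))"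

text \<open>The exit state \<open>fst P\<close> is at the same time the shifted start state of
  \<open>Q\<close>, so control passes on without a connecting step and step counts simply add
  up.\<close>

definition seq :: "prog \<Rightarrow> prog \<Rightarrow> prog" where
  "seq P Q = (fst P + fst Q, \<lambda>q r. if q < fst P then snd P q r
     else (case snd Q (q - fst P) r of (q', a) \<Rightarrow> (q' + fst P, a)))"

lemma wf_progD:
  assumes "wf_prog K S P" and "q < fst P" and "\<And>i. r i \<in> S" and "snd P q r = (q', a)"
  shows "q' \<le> fst P" and "\<And>i. fst (a i) \<in> S" and "\<And>i. i \<ge> K \<Longrightarrow> a i = (r i, Stay)"
  using assms(1)[unfolded wf_prog_def, rule_format, OF assms(2-4)] by auto

lemma act_tape_read [simp]: "act_tape T (read_tape T, d) = (fst T, snd T + offset d)"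
  by (cases T) auto

lemma relpow_chain:
  assumes "\<And>i. i < k \<Longrightarrow> (c i, c (Suc i)) \<in> R"
  shows "(c 0, c k) \<in> R ^^ k"
  using assms by (induction k) auto

lemma relpow_trans: "(a, b) \<in> R ^^ m \<Longrightarrow> (b, c) \<in> R ^^ n \<Longrightarrow> (a, c) \<in> R ^^ (m + n)"
  unfolding relpow_add by blast

lemma relpow_subset: "R \<subseteq> R' \<Longrightarrow> R ^^ n \<subseteq> R' ^^ n" for R R' :: "'a rel"
  by (induction n) auto

lemma runs_seq:
  assumes "runs P \<sigma> t \<sigma>'" and "runs Q \<sigma>' t' \<sigma>''"
  shows "runs (seq P Q) \<sigma> (t + t') \<sigma>''"
proof -
  have "trans P \<subseteq> trans (seq P Q)"
    by (auto simp: trans_def seq_def)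
  then have 1: "((0, \<sigma>), (fst P, \<sigma>')) \<in> trans (seq P Q) ^^ t"
    using assms(1) relpow_subset unfolding runs_def by blast
  have "((q + fst P, \<rho>), (q' + fst P, \<rho>')) \<in> trans (seq P Q) ^^ n"
    if "((q, \<rho>), (q', \<rho>')) \<in> trans Q ^^ n" for q \<rho> q' \<rho>' n
    using that
  proof (induction n arbitrary: q' \<rho>')
    case (Suc n)
    then obtain q1 \<rho>1 where "((q, \<rho>), (q1, \<rho>1)) \<in> trans Q ^^ n" "((q1, \<rho>1), (q', \<rho>')) \<in> trans Q"
      by auto
    moreover from this(2) have "((q1 + fst P, \<rho>1), (q' + fst P, \<rho>')) \<in> trans (seq P Q)"
      by (auto simp: trans_def seq_def)
    ultimately show ?case
      using Suc.IH by auto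
  qed auto
  from this[of 0 \<sigma>' "fst Q" \<sigma>'' t'] assms(2)
  have 2: "((fst P, \<sigma>'), (fst (seq P Q), \<sigma>'')) \<in> trans (seq P Q) ^^ t'"
    by (simp add: runs_def seq_def add.commute)
  show ?thesis
    unfolding runs_def using relpow_trans[OF 1 2] .
qed

lemma wf_prog_seq:
  assumes "wf_prog K S P" and "wf_prog K S Q"
  shows "wf_prog K S (seq P Q)"
  unfolding wf_prog_def
proof (intro allI impI)
  fix q r q' a
  assume *: "q < fst (seq P Q)" "\<forall>i. r i \<in> S" "snd (seq P Q) q r = (q', a)"
  show "q' \<le> fst (seq P Q) \<and> (\<forall>i. fst (a i) \<in> S) \<and> (\<forall>i\<ge>K. a i = (r i, Stay))"
  proof (cases "q < fst P")
    case True
    then have "snd P q r = (q', a)" using * by (simp add: seq_def)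
    with True * assms(1) have "q' \<le> fst P \<and> (\<forall>i. fst (a i) \<in> S) \<and> (\<forall>i\<ge>K. a i = (r i, Stay))"
      unfolding wf_prog_def by blast
    then show ?thesis by (simp add: seq_def)
  next
    case False
    then obtain q1 where "snd Q (q - fst P) r = (q1, a)" "q' = q1 + fst P"
      using * by (auto simp: seq_def split: prod.splits)
    moreover have "q - fst P < fst Q" using False * by (simp add: seq_def)
    ultimately have "q1 \<le> fst Q \<and> (\<forall>i. fst (a i) \<in> S) \<and> (\<forall>i\<ge>K. a i = (r i, Stay))" "q' = q1 + fst P"
      using * assms(2) unfolding wf_prog_def by blast+
    then show ?thesis by (simp add: seq_def)
  qed
qed

text \<open>Lets a program be cut down to \<open>K\<close> tapes: the tapes from \<open>K\<close> on
  keep their initial, blank contents during the whole run.\<close>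

lemma trans_frame:
  assumes "((q, \<sigma>), (q', \<sigma>')) \<in> trans P ^^ t"
    and "wf_prog K S P" and "\<And>i. fst (\<sigma> i) ` UNIV \<subseteq> S"
  shows "(\<forall>i. fst (\<sigma>' i) ` UNIV \<subseteq> S) \<and> (\<forall>i\<ge>K. \<sigma>' i = \<sigma> i)"
  using assms(1)
proof (induction t arbitrary: q' \<sigma>')
  case 0
  then show ?case using assms(3) by auto
next
  case (Suc t)
  then obtain q1 \<sigma>1 a where IH: "(\<forall>i. fst (\<sigma>1 i) ` UNIV \<subseteq> S) \<and> (\<forall>i\<ge>K. \<sigma>1 i = \<sigma> i)"
    and q1: "q1 < fst P" and \<delta>: "snd P q1 (\<lambda>i. read_tape (\<sigma>1 i)) = (q', a)"
    and \<sigma>': "\<sigma>' = (\<lambda>i. act_tape (\<sigma>1 i) (a i))"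
    by (fastforce simp: trans_def)
  have "read_tape (\<sigma>1 i) \<in> S" for i
    using IH by (cases "\<sigma>1 i") (metis fst_conv image_subset_iff read_tape.simps UNIV_I)
  then have a: "fst (a i) \<in> S" "i \<ge> K \<Longrightarrow> a i = (read_tape (\<sigma>1 i), Stay)" for i
    using wf_progD[OF assms(2) q1 _ \<delta>] by auto
  have "fst (\<sigma>' i) ` UNIV \<subseteq> S" for i
  proof -
    have "range (fst (\<sigma>1 i)) \<subseteq> S" using IH by blast
    with a(1)[of i] show ?thesis
      unfolding \<sigma>' by (cases "\<sigma>1 i"; cases "a i") (auto simp: image_subset_iff)
  qed
  moreover have "\<sigma>' i = \<sigma> i" if "i \<ge> K" for i
    using IH a(2)[OF that] that by (simp add: \<sigma>')
  ultimately show ?case by blast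
qed

section \<open>From programs back to Turing machines\<close>

definition blank :: tape where
  "blank = (contents_of [], 0)"

definition init_store :: "str \<Rightarrow> store" where
  "init_store x = (\<lambda>i. if i = 0 then (contents_of (map Bit x), 0) else blank)"

text \<open>\<open>wf_tm\<close> demands the first four symbols; \<open>Aux 0\<close> is the mark in
  front of a word.\<close>

definition base :: "sym set" where
  "base = {Blank, Bit False, Bit True, NotInSet, Aux 0}"

text \<open>Since the tapes from \<open>K\<close> on stay blank, \<open>Blank\<close> is what the
  program would read there. The exit state has the number of the halting state, so the simulation is
  step by step.\<close>

definition tm_of_prog :: "nat \<Rightarrow> sym set \<Rightarrow> prog \<Rightarrow> tm" where
  "tm_of_prog K S P = \<lparr>num_tapes = K, num_states = fst P, alphabet = S,
     delta = (\<lambda>q ss. case snd P q (\<lambda>i. if i < K then ss ! i else Blank) of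
       (q', a) \<Rightarrow> (q', map a [0..<K]))\<rparr>"

lemma contents_of_simps:
  "contents_of [] = (\<lambda>i. Blank)"
  "i < 0 \<Longrightarrow> contents_of w i = Blank"
  "i \<ge> int (length w) \<Longrightarrow> contents_of w i = Blank"
  "k < length w \<Longrightarrow> contents_of w (int k) = w ! k"
  by (auto simp: contents_of_def fun_eq_iff)

lemma wf_tm_of_prog:
  assumes "wf_prog K S P" and "finite S" and "base \<subseteq> S" and "K \<ge> 2"
  shows "wf_tm (tm_of_prog K S P)"
proof -
  have "q' \<le> fst P \<and> (\<forall>i. fst (a i) \<in> S)"
    if "q < fst P" "length ss = K" "set ss \<subseteq> S"
      "snd P q (\<lambda>i. if i < K then ss ! i else Blank) = (q', a)" for q ss q' a
  proof -
    have "\<forall>i. (if i < K then ss ! i else Blank) \<in> S"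
      using that assms(3) by (auto simp: base_def subset_iff)
    then show ?thesis
      using wf_progD[OF assms(1) that(1) _ that(4)] by auto
  qed
  then show ?thesis
    using assms(2-4) by (fastforce simp: wf_tm_def tm_of_prog_def base_def split: prod.splits)
qed

lemma step_tm_of_prog:
  assumes "((q, \<sigma>), (q', \<sigma>')) \<in> trans P" and "\<And>i. i \<ge> K \<Longrightarrow> \<sigma> i = blank"
  shows "step (tm_of_prog K S P) (q, map \<sigma> [0..<K]) = (q', map \<sigma>' [0..<K])"
proof -
  from assms(1) obtain a where q: "q < fst P" and
    \<delta>: "snd P q (\<lambda>i. read_tape (\<sigma> i)) = (q', a)" and \<sigma>': "\<sigma>' = (\<lambda>i. act_tape (\<sigma> i) (a i))"
    by (auto simp: trans_def)
  have "(\<lambda>i. if i < K then map read_tape (map \<sigma> [0..<K]) ! i else Blank) = (\<lambda>i. read_tape (\<sigma> i))"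
    using assms(2) by (auto simp: blank_def contents_of_simps)
  then show ?thesis
    using q \<delta> \<sigma>' by (auto simp: step_def halted_def tm_of_prog_def intro!: nth_equalityI
      split: prod.splits)
qed

lemma polytime_computable_progI:
  assumes wf: "wf_prog K S P" and S: "finite S" "base \<subseteq> S" and K: "K \<ge> 2"
    and run: "\<And>x. \<exists>t \<le> poly p (length x). \<exists>\<sigma>.
      runs P (init_store x) t \<sigma> \<and> fst (\<sigma> 1) = contents_of (f x)"
  shows "polytime_computable f"
proof -
  let ?M = "tm_of_prog K S P"
  have sim: "(step ?M ^^ t) (0, map (init_store x) [0..<K]) = (q, map \<sigma> [0..<K])"
    if "((0, init_store x), (q, \<sigma>)) \<in> trans P ^^ t" for x t q \<sigma>
    using that
  proof (induction t arbitrary: q \<sigma>)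
    case (Suc t)
    then obtain q1 \<sigma>1 where 1: "((0, init_store x), (q1, \<sigma>1)) \<in> trans P ^^ t"
      "((q1, \<sigma>1), (q, \<sigma>)) \<in> trans P" by auto
    have "\<sigma>1 i = blank" if "i \<ge> K" for i
    proof -
      \<comment> \<open>\<open>trans_frame\<close> also needs the symbols of the initial tapes to
        lie in \<open>S\<close>.\<close>
      have "fst (init_store x j) ` UNIV \<subseteq> S" for j
      proof -
        have "Bit b \<in> S" for b using S(2) by (cases b) (auto simp: base_def)
        then show ?thesis
          using S(2) by (auto simp: init_store_def blank_def contents_of_def base_def)
      qed
      from trans_frame[OF 1(1) wf this] that K show ?thesis
        by (auto simp: init_store_def)
    qed
    with Suc.IH[OF 1(1)] step_tm_of_prog[OF 1(2)] show ?case by simp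
  qed auto
  have "map (init_store x) [0..<K] =
      (contents_of (map Bit x), 0) # replicate (K - 1) (contents_of [], 0)" for x
    using K by (auto intro!: nth_equalityI simp: init_store_def blank_def nth_Cons split: nat.splits)
  then have init: "init_config ?M x = (0, map (init_store x) [0..<K])" for x
    by (simp add: init_config_def tm_of_prog_def)
  have "computes_within ?M f (poly p)"
    unfolding computes_within_def
  proof
    fix x
    obtain t \<sigma> where "t \<le> poly p (length x)" "runs P (init_store x) t \<sigma>"
      "fst (\<sigma> 1) = contents_of (f x)" using run by blast
    with K sim[of x "fst P" \<sigma> t] show "\<exists>t\<le>poly p (length x). let c = (step ?M ^^ t) (init_config ?M x)
        in halted ?M c \<and> fst (snd c ! 1) = contents_of (f x)"
      by (intro exI[of _ t]) (simp add: runs_def init halted_def, simp add: tm_of_prog_def)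
  qed
  with wf_tm_of_prog[OF wf S K] show ?thesis
    unfolding polytime_computable_def by blast
qed

section \<open>Preparing words on tapes\<close>

lemma transI:
  assumes "q < fst P" and "snd P q (\<lambda>i. read_tape (\<sigma> i)) = (q', a)"
    and "\<And>i. \<sigma>' i = act_tape (\<sigma> i) (a i)"
  shows "((q, \<sigma>), (q', \<sigma>')) \<in> trans P"
  using assms by (auto simp: trans_def fun_eq_iff)

lemma contents_of_snoc: "(contents_of w)(int (length w) := v) = contents_of (w @ [v])"
  by (auto simp: contents_of_def fun_eq_iff nth_append)

lemma contents_of_snoc_Blank: "contents_of (w @ [Blank]) = contents_of w"
  by (auto simp: contents_of_def fun_eq_iff nth_append)

lemma contents_of_butlast: "(contents_of w)(int (length w) - 1 := Blank) = contents_of (butlast w)"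
  by (cases w rule: rev_cases) (auto simp: contents_of_def fun_eq_iff nth_append)

text \<open>Covers the three ways in which the input is used: with a marking bit appended, with its
  last bit deleted, and (for \<open>v = Blank\<close>) unchanged.\<close>

definition adapt :: "bool \<Rightarrow> sym \<Rightarrow> sym list \<Rightarrow> sym list" where
  "adapt del v w = (if del then butlast w else if v = Blank then w else w @ [v])"

text \<open>State 0 copies to the right, state 1 deletes the last symbol if required, and state 2
  runs back. The way back is controlled by tape 0, because the cell under the head of tape
  \<open>k\<close> may just have been erased. Tape 0 is left as found, ready for the next
  word.\<close>

definition copy :: "nat \<Rightarrow> bool \<Rightarrow> sym \<Rightarrow> prog" where
  "copy k del v = (3, \<lambda>q r.
     if q = 0 then
       if r 0 \<noteq> Blank then (0, \<lambda>i. if i = 0 \<or> i = k then (r 0, Right) else (r i, Stay))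
       else (1, \<lambda>i. if i = 0 then (r 0, Left) else if i = k then (v, Left) else (r i, Stay))
     else if q = 1 then (2, \<lambda>i. if i = k \<and> del then (Blank, Stay) else (r i, Stay))
     else if r 0 \<noteq> Blank then (2, \<lambda>i. if i = 0 \<or> i = k then (r i, Left) else (r i, Stay))
     else (3, \<lambda>i. if i = 0 \<or> i = k then (r i, Right) else (r i, Stay)))"

lemma wf_prog_copy: "k < K \<Longrightarrow> base \<subseteq> S \<Longrightarrow> v \<in> S \<Longrightarrow> wf_prog K S (copy k del v)"
  by (auto simp: wf_prog_def copy_def base_def split: if_splits)

lemma runs_copy:
  assumes k: "k \<noteq> 0" and \<sigma>: "\<sigma> 0 = (contents_of w, 0)" "\<sigma> k = blank"
    and w: "Blank \<notin> set w" and dv: "del \<Longrightarrow> v = Blank"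
  shows "runs (copy k del v) \<sigma> (2 * length w + 3) (\<sigma>(k := (contents_of (adapt del v w), 0)))"
proof -
  let ?P = "copy k del v" and ?n = "length w" and ?u = "adapt del v w"
  define c where "c i = (0::nat, \<sigma>(0 := (contents_of w, int i), k := (contents_of (take i w), int i)))" for i
  define d where "d i = (2::nat, \<sigma>(0 := (contents_of w, int ?n - 1 - int i),
    k := (contents_of ?u, int ?n - 1 - int i)))" for i
  let ?\<rho> = "\<sigma>(0 := (contents_of w, int ?n - 1), k := (contents_of (w @ [v]), int ?n - 1))"
  have "(c i, c (Suc i)) \<in> trans ?P" if "i < ?n" for i
    unfolding c_def
  proof (rule transI)
    have "w ! i \<noteq> Blank" using w that by (metis nth_mem)
    moreover have "(contents_of (take i w))(int i := w ! i) = contents_of (take (Suc i) w)"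
      using contents_of_snoc[of "take i w" "w ! i"] that by (simp add: take_Suc_conv_app_nth)
    ultimately show "(\<sigma>(0 := (contents_of w, int (Suc i)),
        k := (contents_of (take (Suc i) w), int (Suc i)))) j =
      act_tape ((\<sigma>(0 := (contents_of w, int i), k := (contents_of (take i w), int i))) j)
       (if j = 0 \<or> j = k then (w ! i, Right)
        else (read_tape ((\<sigma>(0 := (contents_of w, int i), k := (contents_of (take i w), int i))) j), Stay))" for j
      using k that by (auto simp: contents_of_simps)
    show "snd ?P 0 (\<lambda>j. read_tape ((\<sigma>(0 := (contents_of w, int i), k := (contents_of (take i w), int i))) j))
      = (0, \<lambda>j. if j = 0 \<or> j = k then (w ! i, Right)
        else (read_tape ((\<sigma>(0 := (contents_of w, int i), k := (contents_of (take i w), int i))) j), Stay))"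
      using k that \<open>w ! i \<noteq> Blank\<close> by (simp add: copy_def contents_of_simps cong: if_cong)
  qed (simp add: copy_def)
  from relpow_chain[of ?n c, OF this]
  have 1: "(c 0, c ?n) \<in> trans ?P ^^ ?n" .
  have "(contents_of w)(int ?n := Blank) = contents_of w"
    by (simp add: contents_of_snoc contents_of_snoc_Blank)
  then have 2: "(c ?n, (1, ?\<rho>)) \<in> trans ?P ^^ 1"
    unfolding c_def relpow_1
    by (intro transI) (use k in \<open>auto simp: copy_def contents_of_simps contents_of_snoc[symmetric]\<close>)
  \<comment> \<open>For deletion \<open>v = Blank\<close>, so appending \<open>v\<close> changed
    nothing. If \<open>w\<close> is empty, the erased cell is cell -1, which was blank
    already.\<close>
  have "(contents_of (w @ [v]))(int ?n - 1 := Blank) = contents_of ?u" if del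
    using that dv contents_of_snoc_Blank contents_of_butlast by (simp add: adapt_def)
  moreover have "contents_of (w @ [v]) = contents_of ?u" if "\<not> del"
    using that contents_of_snoc_Blank by (simp add: adapt_def)
  ultimately have 3: "((1, ?\<rho>), d 0) \<in> trans ?P ^^ 1"
    unfolding d_def relpow_1
    by (intro transI) (use k in \<open>auto simp: copy_def\<close>)
  have "(d i, d (Suc i)) \<in> trans ?P" if "i < ?n" for i
  proof -
    have "contents_of w (int ?n - 1 - int i) = w ! (?n - 1 - i)"
      using that contents_of_simps(4)[of "?n - 1 - i" w] by (simp add: of_nat_diff diff_diff_eq)
    moreover have "w ! (?n - 1 - i) \<in> set w" using that by (intro nth_mem) linarith
    then have "w ! (?n - 1 - i) \<noteq> Blank" using w by metis
    ultimately show ?thesis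
      unfolding d_def by (intro transI) (use k in \<open>auto simp: copy_def intro!: fun_upd_idem[symmetric]\<close>)
  qed
  from relpow_chain[of ?n d, OF this]
  have 4: "(d 0, d ?n) \<in> trans ?P ^^ ?n" .
  have 5: "(d ?n, (3, \<sigma>(k := (contents_of ?u, 0)))) \<in> trans ?P ^^ 1"
    unfolding d_def relpow_1
    by (intro transI) (use k \<sigma> in \<open>auto simp: copy_def contents_of_simps intro!: fun_upd_idem[symmetric]\<close>)
  have "c 0 = (0, \<sigma>)"
    using \<sigma> by (auto simp: c_def fun_eq_iff blank_def)
  with relpow_trans[OF 1 relpow_trans[OF 2 relpow_trans[OF 3 relpow_trans[OF 4 5]]]]
  show ?thesis
    unfolding runs_def by (simp add: copy_def mult_2 add.assoc numeral_3_eq_3)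
qed

text \<open>The mark is in cell -1 and the head on the last symbol, or on the mark if
  \<open>w\<close> is empty. That is the least significant end, and the symbol there already tells a
  number from \<open>NotInSet\<close>.\<close>

definition word_tape :: "sym list \<Rightarrow> tape" where
  "word_tape w = (\<lambda>i. contents_of (Aux 0 # w) (i + 1), int (length w) - 1)"

definition mark :: "nat \<Rightarrow> prog" where
  "mark k = (3, \<lambda>q r.
     if q = 0 then (1, \<lambda>i. if i = k then (r i, Left) else (r i, Stay))
     else if q = 1 then (2, \<lambda>i. if i = k then (Aux 0, Right) else (r i, Stay))
     else if r k \<noteq> Blank then (2, \<lambda>i. if i = k then (r i, Right) else (r i, Stay))
     else (3, \<lambda>i. if i = k then (r i, Left) else (r i, Stay)))"

lemma wf_prog_mark: "k < K \<Longrightarrow> base \<subseteq> S \<Longrightarrow> wf_prog K S (mark k)"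
  by (auto simp: wf_prog_def mark_def base_def split: if_splits)

lemma runs_mark:
  assumes \<sigma>: "\<sigma> k = (contents_of w, 0)" and w: "Blank \<notin> set w"
  shows "runs (mark k) \<sigma> (length w + 3) (\<sigma>(k := word_tape w))"
proof -
  let ?n = "length w" and ?W = "\<lambda>i. contents_of (Aux 0 # w) (i + 1)"
  define c where "c i = (2::nat, \<sigma>(k := (?W, int i)))" for i
  have W: "?W (int i) = contents_of w (int i)" for i
    by (auto simp: contents_of_def nth_append nat_add_distrib)
  have 1: "((0, \<sigma>), (1, \<sigma>(k := (contents_of w, -1)))) \<in> trans (mark k) ^^ 1"
    unfolding relpow_1 by (intro transI) (use \<sigma> in \<open>auto simp: mark_def\<close>)
  have "(contents_of w)(-1 := Aux 0) = ?W"
    by (auto simp: contents_of_def fun_eq_iff nth_Cons' nat_add_distrib)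
  then have 2: "((1, \<sigma>(k := (contents_of w, -1))), c 0) \<in> trans (mark k) ^^ 1"
    unfolding relpow_1 c_def by (intro transI) (use \<sigma> in \<open>auto simp: mark_def\<close>)
  have "(c i, c (Suc i)) \<in> trans (mark k)" if "i < ?n" for i
  proof -
    have "w ! i \<noteq> Blank" using w that by (metis nth_mem)
    then have "?W (int i) \<noteq> Blank"
      unfolding W using that by (simp add: contents_of_simps)
    moreover have "?W(int i := ?W (int i)) = ?W" by (rule fun_upd_triv)
    ultimately show ?thesis
      unfolding c_def by (intro transI) (auto simp: mark_def)
  qed
  from relpow_chain[of ?n c, OF this]
  have 3: "(c 0, c ?n) \<in> trans (mark k) ^^ ?n" .
  have "?W (int ?n) = Blank"
    unfolding W by (simp add: contents_of_simps)
  moreover have "?W(int ?n := ?W (int ?n)) = ?W" by (rule fun_upd_triv)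
  ultimately have 4: "(c ?n, (3, \<sigma>(k := word_tape w))) \<in> trans (mark k) ^^ 1"
    unfolding relpow_1 c_def by (intro transI) (auto simp: mark_def word_tape_def)
  from relpow_trans[OF 1 relpow_trans[OF 2 relpow_trans[OF 3 4]]]
  show ?thesis
    unfolding runs_def by (simp add: mark_def numeral_3_eq_3)
qed

section \<open>Running a given machine on a block of tapes\<close>

text \<open>The embedded machine logs the moves of its output head, so that they can be undone afterwards.\<close>

fun log_sym :: "direction \<Rightarrow> sym" where
  "log_sym Left = Bit False"
| "log_sym Stay = NotInSet"
| "log_sym Right = Bit True"

definition undo :: "sym \<Rightarrow> direction" where
  "undo s = (if s = Bit False then Right else if s = Bit True then Left else Stay)"

lemma offset_undo: "offset (undo (log_sym d)) = - offset d"
  by (cases d) (auto simp: undo_def)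

text \<open>Every step leaves a visible entry, so a backward reading of the log meets
  \<open>Blank\<close> only before its first entry.\<close>

lemma log_sym_neq_Blank: "log_sym d \<noteq> Blank"
  by (cases d) auto

text \<open>The machine occupies the tapes from \<open>k\<close> on, its output being tape
  \<open>k + 1\<close>; the log is the tape after its last one. The guard is there for alphabets
  larger than that of \<open>M\<close>, on which \<open>delta\<close> is unconstrained: it keeps the
  program well formed over all of them.\<close>

definition embed :: "tm \<Rightarrow> nat \<Rightarrow> prog" where
  "embed M k = (num_states M, \<lambda>q r.
     case delta M q (map (\<lambda>j. r (k + j)) [0..<num_tapes M]) of (q', acts) \<Rightarrow>
       if q' \<le> num_states M \<and> length acts = num_tapes M \<and> fst ` set acts \<subseteq> alphabet M
       then (q', \<lambda>i. if k \<le> i \<and> i < k + num_tapes M then acts ! (i - k)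
              else if i = k + num_tapes M then (log_sym (snd (acts ! 1)), Right) else (r i, Stay))
       else (num_states M, \<lambda>i. (r i, Stay)))"

lemma wf_prog_embed:
  assumes "k + num_tapes M < K" and "base \<subseteq> S" and "alphabet M \<subseteq> S"
  shows "wf_prog K S (embed M k)"
proof -
  have log: "log_sym d \<in> S" for d
    using assms(2) by (cases d) (auto simp: base_def)
  have acts: "fst (acts ! (i - k)) \<in> S"
    if "fst ` set acts \<subseteq> alphabet M" "k \<le> i" "i < k + length acts"
    for acts :: "(sym \<times> direction) list" and i :: nat
  proof -
    have "acts ! (i - k) \<in> set acts" using that by (intro nth_mem) linarith
    then show ?thesis using that assms(3) by blast
  qed
  show ?thesis
    using assms(1) log
    by (auto simp: wf_prog_def embed_def split: prod.splits if_splits intro!: acts)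
qed

lemma wf_tm_delta:
  assumes "wf_tm M" and "q < num_states M" "length ss = num_tapes M" "set ss \<subseteq> alphabet M"
    and "delta M q ss = (q', acts)"
  shows "q' \<le> num_states M" "length acts = num_tapes M" "fst ` set acts \<subseteq> alphabet M"
  using assms(1)[unfolded wf_tm_def, THEN conjunct2, THEN conjunct2, THEN conjunct2, rule_format,
      OF conjI[OF assms(2) conjI[OF assms(3,4)]]] assms(5)
  by auto

text \<open>Ensures that the guard in \<open>embed\<close> never fails in a genuine run.\<close>

lemma tm_config_ok:
  fixes x :: str
  assumes M: "wf_tm M"
  defines "c \<equiv> \<lambda>t. (step M ^^ t) (init_config M x)"
  shows "fst (c t) \<le> num_states M \<and> length (snd (c t)) = num_tapes M \<and>
    (\<forall>T\<in>set (snd (c t)). range (fst T) \<subseteq> alphabet M)"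
proof (induction t)
  case 0
  have "Bit b \<in> alphabet M" for b using M by (cases b) (auto simp: wf_tm_def)
  then show ?case
    using M by (auto simp: c_def init_config_def wf_tm_def contents_of_def)
next
  case (Suc t)
  obtain q ts where c: "c t = (q, ts)" by fastforce
  have Suc_t: "c (Suc t) = step M (c t)" by (simp add: c_def)
  show ?case
  proof (cases "q = num_states M")
    case True
    then show ?thesis using Suc by (simp add: Suc_t c step_def halted_def)
  next
    case False
    obtain q' acts where \<delta>: "delta M q (map read_tape ts) = (q', acts)" by fastforce
    have "read_tape T \<in> alphabet M" if "T \<in> set ts" for T
      using Suc that by (cases T) (fastforce simp: c)
    then have "q < num_states M" "length (map read_tape ts) = num_tapes M"
      "set (map read_tape ts) \<subseteq> alphabet M"
      using Suc False by (auto simp: c)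
    with \<delta> have \<delta>': "q' \<le> num_states M" "length acts = num_tapes M" "fst ` set acts \<subseteq> alphabet M"
      using wf_tm_delta[OF M] by blast+
    have "range (fst (act_tape T a)) \<subseteq> alphabet M" if "(T, a) \<in> set (zip ts acts)" for T a
    proof -
      have "range (fst T) \<subseteq> alphabet M" "fst a \<in> alphabet M"
        using set_zip_leftD[OF that] set_zip_rightD[OF that] Suc \<delta>'(3) by (auto simp: c)
      then show ?thesis by (cases T; cases a) (auto simp: image_subset_iff)
    qed
    then have "\<forall>T\<in>set (map2 act_tape ts acts). range (fst T) \<subseteq> alphabet M"
      unfolding set_map by (intro ballI, elim imageE) (simp add: split_beta)
    then show ?thesis
      using \<delta>' Suc False by (simp add: Suc_t c step_def halted_def \<delta>)
  qed
qed

text \<open>A halted machine idles under \<open>step\<close>, but a program has no transition out of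
  its exit state; so the simulation is claimed only while the machine is running. The offsets in
  \<open>ds\<close> sum to the output head position because that head starts at 0.\<close>

lemma embed_steps:
  fixes x :: str
  assumes M: "wf_tm M"
  defines "c \<equiv> \<lambda>t. (step M ^^ t) (init_config M x)" and "n \<equiv> num_tapes M"
  assumes running: "\<And>s. s < t \<Longrightarrow> \<not> halted M (c s)"
    and \<sigma>: "\<sigma> k = (contents_of (map Bit x), 0)" "\<And>j. 0 < j \<Longrightarrow> j \<le> n \<Longrightarrow> \<sigma> (k + j) = blank"
  shows "\<exists>\<sigma>' ds. ((0, \<sigma>), (fst (c t), \<sigma>')) \<in> trans (embed M k) ^^ t \<and>
    (\<forall>j<n. \<sigma>' (k + j) = snd (c t) ! j) \<and> length ds = t \<and>
    \<sigma>' (k + n) = (contents_of (map log_sym ds), int t) \<and>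
    snd (snd (c t) ! 1) = sum_list (map offset ds) \<and>
    (\<forall>i. i < k \<or> i > k + n \<longrightarrow> \<sigma>' i = \<sigma> i)"
  using running
proof (induction t)
  case 0
  have n: "n \<ge> 2" using M by (simp add: wf_tm_def n_def)
  have "snd (c 0) ! j = \<sigma> (k + j)" if "j < n" for j
    using \<sigma>(1) \<sigma>(2)[of j] that n
    by (cases j) (auto simp: c_def init_config_def blank_def n_def)
  with n show ?case
    using \<sigma>(2)[of 1] \<sigma>(2)[of n]
    by (intro exI[of _ \<sigma>] exI[of _ "[]"]) (auto simp: c_def init_config_def blank_def n_def)
next
  case (Suc t)
  then obtain \<sigma>1 ds where IH: "((0, \<sigma>), (fst (c t), \<sigma>1)) \<in> trans (embed M k) ^^ t"
    "\<forall>j<n. \<sigma>1 (k + j) = snd (c t) ! j" "length ds = t"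
    "\<sigma>1 (k + n) = (contents_of (map log_sym ds), int t)"
    "snd (snd (c t) ! 1) = sum_list (map offset ds)"
    "\<forall>i. i < k \<or> i > k + n \<longrightarrow> \<sigma>1 i = \<sigma> i"
    by (metis (lifting) less_SucI)
  have n: "n \<ge> 2" using M by (simp add: wf_tm_def n_def)
  obtain q ts where c: "c t = (q, ts)" by fastforce
  have ok: "q \<le> num_states M" "length ts = n" "\<forall>T\<in>set ts. range (fst T) \<subseteq> alphabet M"
    using tm_config_ok[OF M, of t x] c unfolding c_def n_def by auto
  have q: "q < num_states M" using ok(1) Suc.prems[of t] by (simp add: halted_def c)
  obtain q' acts where \<delta>: "delta M q (map read_tape ts) = (q', acts)" by fastforce
  have "read_tape T \<in> alphabet M" if "T \<in> set ts" for T
    using ok that by (cases T) fastforce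
  then have "length (map read_tape ts) = num_tapes M" "set (map read_tape ts) \<subseteq> alphabet M"
    using ok by (auto simp: n_def)
  with \<delta> q have \<delta>': "q' \<le> num_states M" "length acts = n" "fst ` set acts \<subseteq> alphabet M"
    using wf_tm_delta[OF M] unfolding n_def by blast+
  have Suc_t: "c (Suc t) = (q', map2 act_tape ts acts)"
    using q \<delta> c by (simp add: c_def step_def halted_def)
  define a where "a = (\<lambda>i. if k \<le> i \<and> i < k + n then acts ! (i - k)
    else if i = k + n then (log_sym (snd (acts ! 1)), Right) else (read_tape (\<sigma>1 i), Stay))"
  let ?\<sigma> = "\<lambda>i. act_tape (\<sigma>1 i) (a i)" and ?ds = "ds @ [snd (acts ! 1)]"
  have "map (\<lambda>j. read_tape (\<sigma>1 (k + j))) [0..<num_tapes M] = map read_tape ts"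
    using IH(2) ok(2) c by (intro nth_equalityI) (auto simp: n_def)
  then have "((q, \<sigma>1), (q', ?\<sigma>)) \<in> trans (embed M k)"
    using q \<delta> \<delta>' by (intro transI[where a = a]) (auto simp: embed_def a_def n_def)
  with IH(1) c have "((0, \<sigma>), (fst (c (Suc t)), ?\<sigma>)) \<in> trans (embed M k) ^^ Suc t"
    by (auto simp: Suc_t)
  moreover have "\<forall>j<n. ?\<sigma> (k + j) = snd (c (Suc t)) ! j"
    using IH(2) \<delta>' ok(2) c by (auto simp: Suc_t a_def)
  moreover have "?\<sigma> (k + n) = (contents_of (map log_sym ?ds), int (Suc t))"
    using IH(3,4) contents_of_snoc[of "map log_sym ds"] by (simp add: a_def)
  moreover have "snd (snd (c (Suc t)) ! 1) = sum_list (map offset ?ds)"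
    using IH(5) c ok(2) \<delta>'(2) n
    by (cases "ts ! 1"; cases "acts ! 1") (simp add: Suc_t)
  moreover have "\<forall>i. i < k \<or> i > k + n \<longrightarrow> ?\<sigma> i = \<sigma> i"
    using IH(6) by (simp add: a_def)
  ultimately show ?case
    using IH(3) by (intro exI[of _ ?\<sigma>] exI[of _ ?ds]) simp
qed

lemma runs_embed:
  assumes M: "wf_tm M" and f: "computes_within M f T"
    and \<sigma>: "\<sigma> k = (contents_of (map Bit x), 0)"
      "\<And>j. 0 < j \<Longrightarrow> j \<le> num_tapes M \<Longrightarrow> \<sigma> (k + j) = blank"
  shows "\<exists>t \<sigma>' ds. t \<le> T (length x) \<and> runs (embed M k) \<sigma> t \<sigma>' \<and> length ds = t \<and>
    \<sigma>' (k + 1) = (contents_of (f x), sum_list (map offset ds)) \<and>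
    \<sigma>' (k + num_tapes M) = (contents_of (map log_sym ds), int t) \<and>
    (\<forall>i. i < k \<or> i > k + num_tapes M \<longrightarrow> \<sigma>' i = \<sigma> i)"
proof -
  let ?c = "\<lambda>t. (step M ^^ t) (init_config M x)"
  obtain t where t: "t \<le> T (length x)" "halted M (?c t)" "fst (snd (?c t) ! 1) = contents_of (f x)"
    using f unfolding computes_within_def Let_def by blast
  \<comment> \<open>The time \<open>t\<close> of \<open>computes_within\<close> may come after
    halting. The first halting time has the same configuration, since nothing changes
    afterwards.\<close>
  define s where "s = (LEAST s. halted M (?c s))"
  have s: "halted M (?c s)" "s \<le> t" and running: "\<And>r. r < s \<Longrightarrow> \<not> halted M (?c r)"
    using LeastI[of "\<lambda>s. halted M (?c s)", OF t(2)] Least_le[of "\<lambda>s. halted M (?c s)", OF t(2)]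
      not_less_Least[of _ "\<lambda>s. halted M (?c s)"]
    unfolding s_def by auto
  have "?c (s + d) = ?c s" for d
    using s(1) by (induction d) (auto simp: step_def)
  from this[of "t - s"] s(2) have eq: "?c s = ?c t" by simp
  have n: "num_tapes M \<ge> 2" using M by (simp add: wf_tm_def)
  obtain \<sigma>' ds where *: "((0, \<sigma>), (fst (?c s), \<sigma>')) \<in> trans (embed M k) ^^ s"
    "\<forall>j<num_tapes M. \<sigma>' (k + j) = snd (?c s) ! j" "length ds = s"
    "\<sigma>' (k + num_tapes M) = (contents_of (map log_sym ds), int s)"
    "snd (snd (?c s) ! 1) = sum_list (map offset ds)"
    "\<forall>i. i < k \<or> i > k + num_tapes M \<longrightarrow> \<sigma>' i = \<sigma> i"
    using embed_steps[where t = s and \<sigma> = \<sigma> and k = k and x = x, OF M running \<sigma>] by blast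
  have "\<sigma>' (k + 1) = (contents_of (f x), sum_list (map offset ds))"
    using *(2)[rule_format, of 1] *(5) n t(3) by (intro prod_eqI) (auto simp: eq)
  moreover have "fst (?c s) = fst (embed M k)"
    using s(1) by (simp add: halted_def embed_def)
  ultimately show ?thesis
    using * s(2) t(1) unfolding runs_def
    by (intro exI[of _ s] exI[of _ \<sigma>'] exI[of _ ds]) auto
qed

text \<open>The surroundings of the output head do not tell on which side the output lies, so its
  moves are inverted one by one, last move first.\<close>

definition unwind :: "nat \<Rightarrow> nat \<Rightarrow> prog" where
  "unwind k l = (2, \<lambda>q r.
     if q = 0 then (1, \<lambda>i. if i = l then (r i, Left) else (r i, Stay))
     else if r l = Blank then (2, \<lambda>i. (r i, Stay))
     else (1, \<lambda>i. if i = l then (r i, Left) else if i = k then (r i, undo (r l)) else (r i, Stay)))"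

lemma wf_prog_unwind: "k < K \<Longrightarrow> l < K \<Longrightarrow> base \<subseteq> S \<Longrightarrow> wf_prog K S (unwind k l)"
  by (auto simp: wf_prog_def unwind_def base_def split: if_splits)

lemma runs_unwind:
  assumes "k \<noteq> l" and \<sigma>: "\<sigma> l = (contents_of (map log_sym ds), int (length ds))"
    "\<sigma> k = (A, sum_list (map offset ds))"
  shows "\<exists>\<sigma>'. runs (unwind k l) \<sigma> (length ds + 2) \<sigma>' \<and> \<sigma>' k = (A, 0) \<and>
    (\<forall>i. i \<noteq> k \<longrightarrow> i \<noteq> l \<longrightarrow> \<sigma>' i = \<sigma> i)"
proof -
  let ?P = "unwind k l" and ?n = "length ds" and ?L = "contents_of (map log_sym ds)"
  define c where "c i = (1::nat, \<sigma>(l := (?L, int ?n - 1 - int i),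
    k := (A, sum_list (map offset (take (?n - i) ds)))))" for i
  have 1: "((0, \<sigma>), c 0) \<in> trans ?P ^^ 1"
    unfolding relpow_1 c_def by (intro transI) (use assms in \<open>auto simp: unwind_def\<close>)
  have "(c i, c (Suc i)) \<in> trans ?P" if "i < ?n" for i
  proof -
    let ?m = "?n - Suc i"
    have L: "?L (int ?n - 1 - int i) = log_sym (ds ! ?m)"
      using that contents_of_simps(4)[of ?m "map log_sym ds"]
      by (simp add: of_nat_diff diff_diff_eq)
    have "take (?n - i) ds = take ?m ds @ [ds ! ?m]"
      using that take_Suc_conv_app_nth[of ?m ds] by (simp add: Suc_diff_Suc)
    with L show ?thesis
      unfolding c_def
      by (intro transI) (use assms(1) in \<open>auto simp: unwind_def log_sym_neq_Blank offset_undo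
        intro!: fun_upd_idem[symmetric]\<close>)
  qed
  from relpow_chain[of ?n c, OF this]
  have 2: "(c 0, c ?n) \<in> trans ?P ^^ ?n" .
  have 3: "(c ?n, (2, snd (c ?n))) \<in> trans ?P ^^ 1"
    unfolding relpow_1 c_def
    by (intro transI) (use assms(1) in \<open>auto simp: unwind_def contents_of_simps intro!: fun_upd_idem[symmetric]\<close>)
  from relpow_trans[OF 1 relpow_trans[OF 2 3]]
  have "runs ?P \<sigma> (?n + 2) (snd (c ?n))"
    unfolding runs_def by (simp add: unwind_def numeral_2_eq_2)
  then show ?thesis
    using assms(1) by (intro exI[of _ "snd (c ?n)"]) (simp add: c_def)
qed

section \<open>Serial arithmetic\<close>

text \<open>
  A binary numeral without its leading 1 is the string of the number minus 1. So the mark that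
  \<^const>\<open>word_tape\<close> puts in front of a string serves as its leading 1.
\<close>

definition digit :: "sym \<Rightarrow> int" where
  "digit s = (if s = Bit True \<or> s = Aux 0 then 1 else 0)"

fun lsb_val :: "sym list \<Rightarrow> int" where
  "lsb_val [] = 0"
| "lsb_val (s # l) = digit s + 2 * lsb_val l"

definition word_val :: "sym list \<Rightarrow> int" where
  "word_val w = lsb_val (rev (Aux 0 # w))"

text \<open>Appending a bit takes the dyadic value \<open>d\<close> to \<open>2 * d + 1\<close> or
  \<open>2 * d + 2\<close>, hence \<open>d + 1\<close> to \<open>2 * (d + 1)\<close> or
  \<open>2 * (d + 1) + 1\<close>. This is how a binary numeral grows, starting from 1 for the empty
  string.\<close>

lemma word_val_Bits: "word_val (map Bit u) = int (dyadic u) + 1"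
  by (induction u rule: rev_induct) (auto simp: word_val_def digit_def)

lemma word_tape_read:
  "fst (word_tape w) (snd (word_tape w) - int i) =
    (if i \<le> length w then rev (Aux 0 # w) ! i else Blank)"
proof (cases "i \<le> length w")
  case True
  then have "int (length w) - int i = int (length w - i)" by simp
  then have "fst (word_tape w) (snd (word_tape w) - int i) = (Aux 0 # w) ! (length w - i)"
    using True by (simp add: word_tape_def contents_of_def del: of_nat_diff)
  also have "\<dots> = rev (Aux 0 # w) ! i"
    using True by (subst rev_nth) auto
  finally show ?thesis using True by simp
next
  case False
  then show ?thesis by (simp add: word_tape_def contents_of_simps)
qed

lemma read_word_tape: "read_tape (word_tape w) = last (Aux 0 # w)"
  using word_tape_read[of w 0] hd_rev[of "Aux 0 # w"]
  by (cases "word_tape w") (simp add: hd_conv_nth)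

text \<open>Holds beyond the mark as well, because \<open>Blank\<close> has digit 0: shorter words
  are padded with zeros for free.\<close>

lemma lsb_val_drop:
  "lsb_val (drop i (rev (Aux 0 # w))) =
    digit (fst (word_tape w) (snd (word_tape w) - int i)) + 2 * lsb_val (drop (Suc i) (rev (Aux 0 # w)))"
proof (cases "i \<le> length w")
  case True
  then have "drop i (rev (Aux 0 # w)) = rev (Aux 0 # w) ! i # drop (Suc i) (rev (Aux 0 # w))"
    by (intro Cons_nth_drop_Suc[symmetric]) auto
  then show ?thesis using True by (simp only: word_tape_read lsb_val.simps if_True)
next
  case False
  then show ?thesis by (simp add: word_tape_read digit_def)
qed

definition bits :: "int \<Rightarrow> nat \<Rightarrow> bool list" where
  "bits H n = rev (map (\<lambda>i. odd (H div 2 ^ i)) [0..<n])"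

lemma bits_Suc: "bits H (Suc n) = odd (H div 2 ^ n) # bits H n"
  by (simp add: bits_def)

lemma bits_Suc': "bits H (Suc n) = bits (H div 2) n @ [odd H]"
proof -
  have "[0..<Suc n] = 0 # map Suc [0..<n]"
    by (simp add: map_Suc_upt upt_conv_Cons del: upt_Suc)
  then show ?thesis
    by (simp add: bits_def rev_map comp_def zdiv_zmult2_eq del: upt_Suc)
qed

text \<open>Converse of \<open>word_val_Bits\<close>: without leading zeros and the leading 1, the
  binary digits of \<open>H\<close> form the string of \<open>H - 1\<close>. The induction removes
  the least significant digit.\<close>

lemma bits_strip:
  assumes "H \<ge> 1" and "H < 2 ^ n"
  shows "\<exists>z u. bits H n = replicate z False @ True # u \<and> int (dyadic u) + 1 = H"
  using assms
proof (induction n arbitrary: H)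
  case (Suc n)
  show ?case
  proof (cases "H = 1")
    case True
    have "bits 0 n = replicate n False"
      by (intro nth_equalityI) (auto simp: bits_def rev_nth)
    then show ?thesis
      using True by (intro exI[of _ n] exI[of _ "[]"]) (simp add: bits_Suc')
  next
    case False
    then have "H div 2 \<ge> 1" "H div 2 < 2 ^ n" using Suc.prems by auto
    from Suc.IH[OF this] obtain z u where
      "bits (H div 2) n = replicate z False @ True # u" "int (dyadic u) + 1 = H div 2" by blast
    then show ?thesis
      by (intro exI[of _ z] exI[of _ "u @ [odd H]"]) (auto simp: bits_Suc' elim: oddE)
  qed
qed auto

text \<open>State 0 is the start, so codes are shifted by 1. The cap at \<open>N\<close> gives a
  legal state whatever the carry; correct runs stay below it.\<close>

definition carry_state :: "nat \<Rightarrow> int list \<times> int \<Rightarrow> nat" where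
  "carry_state N p = min N (Suc (to_nat p))"

text \<open>The digits of the sum are written leftwards on tape \<open>l\<close> from cell 0 on. The
  last step moves back onto the most significant one.\<close>

definition adder :: "(sym list \<Rightarrow> (int list \<times> int) option) \<Rightarrow> nat \<Rightarrow> nat list \<Rightarrow> nat \<Rightarrow> prog" where
  "adder sel N js l = (N, \<lambda>q r.
     if q = 0 then
       (case sel (map r js) of
          None \<Rightarrow> (N, \<lambda>i. if i = l then (NotInSet, Stay) else (r i, Stay))
        | Some p \<Rightarrow> (carry_state N p, \<lambda>i. (r i, Stay)))
     else
       (case from_nat (q - 1) of (cs, C) \<Rightarrow>
          if (\<forall>j\<in>set js. r j = Blank) \<and> C = 0
          then (N, \<lambda>i. if i = l then (r i, Right) else (r i, Stay))
          else let v = (\<Sum>i<length js. cs ! i * digit (r (js ! i))) + C in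
            (carry_state N (cs, v div 2), \<lambda>i. if i = l then (Bit (odd v), Left)
               else if i \<in> set js then (r i, Left) else (r i, Stay))))"

lemma wf_prog_adder:
  assumes "l < K" and "\<forall>j\<in>set js. j < K" and "base \<subseteq> S"
  shows "wf_prog K S (adder sel N js l)"
proof -
  have "Bit b \<in> S" for b
    using assms(3) by (cases b) (auto simp: base_def)
  then show ?thesis
    using assms
    by (auto simp: wf_prog_def adder_def carry_state_def base_def Let_def
        split: if_splits option.splits prod.splits)
qed

lemma runs_adder_None:
  assumes "N > 0" and "sel (map (\<lambda>j. read_tape (\<sigma> j)) js) = None" and "\<sigma> l = blank"
  shows "runs (adder sel N js l) \<sigma> 1 (\<sigma>(l := (contents_of [NotInSet], 0)))"
  unfolding runs_def relpow_1
  by (intro transI)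
    (use assms contents_of_snoc[of "[]" NotInSet] in \<open>auto simp: adder_def blank_def\<close>)

text \<open>
  In step \<open>i\<close> of the adder the carry plus the combination of the unread parts of the words
  equals \<open>H div 2 ^ i\<close>, where \<open>H\<close> is the whole linear combination.
\<close>

lemma runs_adder_Some:
  assumes sel: "sel (map (\<lambda>j. read_tape (\<sigma> j)) js) = Some (cs, c)"
    and \<sigma>: "length ws = length js" "\<And>i. i < length js \<Longrightarrow> \<sigma> (js ! i) = word_tape (ws ! i)" "\<sigma> l = blank"
    and l: "l \<notin> set js"
    and ws: "\<And>w. w \<in> set ws \<Longrightarrow> Blank \<notin> set w \<and> length w \<le> L"
    and m: "\<bar>c\<bar> \<le> int m" "(\<Sum>i<length js. \<bar>cs ! i\<bar>) \<le> int m"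
    and N: "\<And>C. \<bar>C\<bar> \<le> int m \<Longrightarrow> Suc (to_nat (cs, C)) < N"
    and H: "H = (\<Sum>i<length js. cs ! i * word_val (ws ! i)) + c" "H \<ge> 1"
  shows "\<exists>n \<sigma>'. n \<le> L + 1 + m \<and> H < 2 ^ n \<and> runs (adder sel N js l) \<sigma> (n + 2) \<sigma>' \<and>
    \<sigma>' l = (\<lambda>i. contents_of (map Bit (bits H n)) (i - (1 - int n)), 1 - int n) \<and>
    (\<forall>i. i \<noteq> l \<longrightarrow> i \<notin> set js \<longrightarrow> \<sigma>' i = \<sigma> i)"
proof -
  let ?P = "adder sel N js l" and ?k = "length js"
  define d where "d j i = digit (fst (word_tape (ws ! j)) (snd (word_tape (ws ! j)) - int i))" for j i
  define V where "V j i = lsb_val (drop i (rev (Aux 0 # ws ! j)))" for j i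
  define v where "v i C = (\<Sum>j<?k. cs ! j * d j i) + C" for i C
  define C where "C = rec_nat c (\<lambda>i C. v i C div 2)"
  define R where "R i = (\<Sum>j<?k. cs ! j * V j i) + C i" for i
  have C_0: "C 0 = c" and C_Suc: "C (Suc i) = v i (C i) div 2" for i
    by (simp_all add: C_def)
  have d: "\<bar>d j i\<bar> \<le> 1" for j i
    by (simp add: d_def digit_def)
  \<comment> \<open>The digits are 0 or 1, so the current column adds at most \<open>m\<close> to a
    carry of at most \<open>m\<close> in absolute value; halving brings \<open>2 * m\<close> back to
    \<open>m\<close>.\<close>
  have "\<bar>C i\<bar> \<le> int m" for i
  proof (induction i)
    case (Suc i)
    have "\<bar>\<Sum>j<?k. cs ! j * d j i\<bar> \<le> (\<Sum>j<?k. \<bar>cs ! j\<bar> * 1)"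
      by (intro order.trans[OF sum_abs] sum_mono) (simp add: abs_mult d mult_left_le)
    then have "\<bar>v i (C i)\<bar> \<le> 2 * int m"
      using m(2) Suc by (simp add: v_def)
    then show ?case by (simp add: C_Suc)
  qed (simp add: C_0 m(1))
  then have C: "\<bar>C i\<bar> \<le> int m" "Suc (to_nat (cs, C i)) < N" for i
    using N by auto
  have V: "V j i = d j i + 2 * V j (Suc i)" for j i
    unfolding V_def d_def by (rule lsb_val_drop)
  have R: "R i = v i (C i) + 2 * (\<Sum>j<?k. cs ! j * V j (Suc i))" for i
    by (simp add: R_def v_def V[of _ i] algebra_simps sum.distrib sum_distrib_left)
  have R_div: "R i = H div 2 ^ i" for i
  proof (induction i)
    case 0
    show ?case by (simp add: R_def H(1) C_0 V_def word_val_def)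
  next
    case (Suc i)
    \<comment> \<open>The unread parts enter \<open>R i\<close> with a factor 2, so rounding affects
      only the current column.\<close>
    have "R (Suc i) = R i div 2" unfolding R[of i] by (simp add: R_def C_Suc)
    then show ?case using Suc by (simp add: power_Suc2 zdiv_zmult2_eq del: power_Suc)
  qed
  have odd_v: "odd (v i (C i)) \<longleftrightarrow> odd (H div 2 ^ i)" for i
    unfolding R_div[symmetric] R[of i] by simp
  have len: "length (ws ! j) \<le> L" if "j < ?k" for j
    using ws \<sigma>(1) that by simp
  have V_0: "V j i = 0" if "length (ws ! j) < i" for j i
    using that by (simp add: V_def)
  \<comment> \<open>The halting test of the adder. A word of length \<open>n\<close> occupies the
    offsets 0 to \<open>n\<close> from the head, the last being the mark, so blanks begin at offset
    \<open>n + 1\<close>.\<close>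
  define fin where "fin i \<longleftrightarrow> (\<forall>j<?k. length (ws ! j) < i) \<and> C i = 0" for i
  have R_fin: "R i = C i" if "\<forall>j<?k. length (ws ! j) < i" for i
    using that by (simp add: R_def V_0)
  \<comment> \<open>After \<open>L + 1\<close> steps all words are used up and the carry alone is
    \<open>H div 2 ^ (L + 1)\<close>. It lies between 0 and \<open>m\<close>, hence below
    \<open>2 ^ m\<close>, and vanishes after \<open>m\<close> more halvings.\<close>
  have "fin (L + 1 + m)"
  proof -
    have ex: "\<forall>j<?k. length (ws ! j) < L + 1 + i" for i
    proof (intro allI impI)
      fix j assume "j < ?k"
      from len[OF this] show "length (ws ! j) < L + 1 + i" by simp
    qed
    have "R (L + 1) = C (L + 1)" using R_fin[OF ex[of 0]] by simp
    then have "R (L + 1) < 2 ^ m"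
      using C(1)[of "L + 1"] of_nat_less_two_power[of m, where 'a = int] by linarith
    moreover have "R (L + 1) \<ge> 0"
      unfolding R_div using H(2) by (simp add: pos_imp_zdiv_nonneg_iff)
    ultimately have "R (L + 1) div 2 ^ m = 0" by simp
    then have "R (L + 1 + m) = 0"
      unfolding R_div by (simp add: power_add zdiv_zmult2_eq[symmetric] mult.assoc)
    with R_fin[OF ex[of m]] ex[of m] show ?thesis by (simp add: fin_def)
  qed
  then obtain n where n: "fin n" "n \<le> L + 1 + m" and running: "\<And>i. i < n \<Longrightarrow> \<not> fin i"
    using LeastI[of "fin"] Least_le[of "fin"] not_less_Least[of _ "fin"] by blast
  have "H div 2 ^ n = 0"
    using R_fin[of n] n(1) R_div[of n] by (simp add: fin_def)
  then have "H < 2 ^ n"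
    using H(2) by (simp add: zdiv_eq_0_iff)
  \<comment> \<open>After \<open>i\<close> steps the low \<open>i\<close> digits of \<open>H\<close>
    fill the cells \<open>1 - i\<close> to 0 of tape \<open>l\<close>, and the head waits on the
    blank cell to their left.\<close>
  define \<rho> where "\<rho> i t = (if t = l then (\<lambda>p. contents_of (map Bit (bits H i)) (p - (1 - int i)), - int i)
    else if t \<in> set js then (fst (\<sigma> t), snd (\<sigma> t) - int i) else \<sigma> t)" for i t
  have rd: "read_tape (\<rho> i (js ! j)) = fst (word_tape (ws ! j)) (snd (word_tape (ws ! j)) - int i)"
    if "j < ?k" for i j
    using \<sigma>(2)[OF that] that l by (auto simp: \<rho>_def)
  have rd_Blank: "read_tape (\<rho> i (js ! j)) = Blank \<longleftrightarrow> length (ws ! j) < i" if "j < ?k" for i j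
  proof (cases "length (ws ! j) < i")
    case False
    then have "rev (Aux 0 # ws ! j) ! i \<in> set (rev (Aux 0 # ws ! j))"
      by (intro nth_mem) simp
    moreover have "ws ! j \<in> set ws" using that \<sigma>(1) by simp
    ultimately have "rev (Aux 0 # ws ! j) ! i \<noteq> Blank" using ws by auto
    then show ?thesis using rd[OF that, of i] False unfolding word_tape_read by simp
  qed (simp add: rd[OF that] word_tape_read)
  then have all_Blank: "(\<forall>t\<in>set js. read_tape (\<rho> i t) = Blank) \<longleftrightarrow> (\<forall>j<?k. length (ws ! j) < i)" for i
    by (metis in_set_conv_nth)
  have sum_v: "(\<Sum>j<?k. cs ! j * digit (read_tape (\<rho> i (js ! j)))) + C i = v i (C i)" for i
    unfolding v_def d_def by (simp add: rd)
  define c where "c i = (Suc (to_nat (cs, C i)), \<rho> i)" for i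
  have "\<rho> 0 = \<sigma>"
    using \<sigma>(3) by (auto simp: \<rho>_def fun_eq_iff bits_def blank_def contents_of_simps)
  then have 1: "((0, \<sigma>), c 0) \<in> trans ?P ^^ 1"
    unfolding relpow_1 c_def
    by (intro transI)
      (use sel C(2)[of 0] in \<open>auto simp: adder_def carry_state_def C_0\<close>)
  have "(c i, c (Suc i)) \<in> trans ?P" if "i < n" for i
    unfolding c_def
  proof (rule transI)
    have "\<not> ((\<forall>t\<in>set js. read_tape (\<rho> i t) = Blank) \<and> C i = 0)"
      using running[OF that] by (simp add: all_Blank fin_def)
    then show "snd ?P (Suc (to_nat (cs, C i))) (\<lambda>t. read_tape (\<rho> i t)) =
      (Suc (to_nat (cs, C (Suc i))), \<lambda>t. if t = l then (Bit (odd (H div 2 ^ i)), Left)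
        else if t \<in> set js then (read_tape (\<rho> i t), Left) else (read_tape (\<rho> i t), Stay))"
      using C(2)[of "Suc i"]
      by (simp add: adder_def carry_state_def sum_v odd_v C_Suc[symmetric] Let_def del: even_add odd_add cong: if_cong)
    have "(\<lambda>p. contents_of w (p - (1 - int i)))(- int i := s) =
        (\<lambda>p. contents_of (s # w) (p - (1 - int (Suc i))))" for w s
      by (auto simp: fun_eq_iff contents_of_def nth_Cons' nat_diff_distrib' intro!: arg_cong[where f = "nth w"])
    then show "\<rho> (Suc i) t = act_tape (\<rho> i t) (if t = l then (Bit (odd (H div 2 ^ i)), Left)
        else if t \<in> set js then (read_tape (\<rho> i t), Left) else (read_tape (\<rho> i t), Stay))" for t
      by (auto simp: \<rho>_def bits_Suc)
  qed (use C(2)[of i] in \<open>simp add: adder_def\<close>)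
  from relpow_chain[of n c, OF this]
  have 2: "(c 0, c n) \<in> trans ?P ^^ n" .
  let ?\<sigma> = "(\<rho> n)(l := (fst (\<rho> n l), 1 - int n))"
  have "(\<forall>t\<in>set js. read_tape (\<rho> n t) = Blank) \<and> C n = 0"
    using n(1) by (simp add: all_Blank fin_def)
  moreover have "snd (\<rho> n l) = - int n" by (simp add: \<rho>_def)
  ultimately have 3: "(c n, (N, ?\<sigma>)) \<in> trans ?P ^^ 1"
    unfolding relpow_1 c_def
    by (intro transI) (use C(2)[of n] in \<open>auto simp: adder_def\<close>)
  from relpow_trans[OF 1 relpow_trans[OF 2 3]]
  have "runs ?P \<sigma> (n + 2) ?\<sigma>"
    unfolding runs_def by (simp add: adder_def)
  with n(2) \<open>H < 2 ^ n\<close> show ?thesis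
    by (intro exI[of _ n] exI[of _ ?\<sigma>]) (simp add: \<rho>_def)
qed

text \<open>The output must begin in cell 0 of tape 1, but the sum ends in cell 0 of its tape.
  Copying moves it, and drops the leading zeros and the leading 1 on the way;
  \<open>NotInSet\<close> is passed on as it is.\<close>

definition emit :: "nat \<Rightarrow> prog" where
  "emit l = (2, \<lambda>q r.
     if q = 0 then
       if r l = Bit False then (0, \<lambda>i. if i = l then (r i, Right) else (r i, Stay))
       else if r l = Bit True then (1, \<lambda>i. if i = l then (r i, Right) else (r i, Stay))
       else (2, \<lambda>i. if i = 1 then (r l, Stay) else (r i, Stay))
     else
       if r l = Blank then (2, \<lambda>i. (r i, Stay))
       else (1, \<lambda>i. if i = l \<or> i = 1 then (r l, Right) else (r i, Stay)))"

lemma wf_prog_emit: "1 < K \<Longrightarrow> l < K \<Longrightarrow> base \<subseteq> S \<Longrightarrow> wf_prog K S (emit l)"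
  by (auto simp: wf_prog_def emit_def base_def split: if_splits)

lemma runs_emit_NotInSet:
  assumes "l \<noteq> 1" and "\<sigma> 1 = blank" and "\<sigma> l = (contents_of [NotInSet], 0)"
  shows "runs (emit l) \<sigma> 1 (\<sigma>(1 := (contents_of [NotInSet], 0)))"
  unfolding runs_def relpow_1
  by (intro transI)
    (use assms contents_of_snoc[of "[]" NotInSet] in
      \<open>auto simp: emit_def blank_def contents_of_simps(4)[of 0, simplified]\<close>)

lemma runs_emit:
  assumes l: "l \<noteq> 1" and \<sigma>: "\<sigma> 1 = blank"
    "\<sigma> l = (\<lambda>i. contents_of (map Bit (replicate z False @ True # u)) (i - p), p)"
  shows "\<exists>\<sigma>'. runs (emit l) \<sigma> (z + 2 + length u) \<sigma>' \<and> fst (\<sigma>' 1) = contents_of (map Bit u)"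
proof -
  let ?w = "map Bit (replicate z False @ True # u)" and ?P = "emit l"
  let ?W = "\<lambda>i. contents_of ?w (i - p)"
  define c where "c i = (0::nat, \<sigma>(l := (?W, p + int i)))" for i
  define d where "d i = (1::nat, \<sigma>(l := (?W, p + int (z + 1 + i)),
    1 := (contents_of (map Bit (take i u)), int i)))" for i
  have W: "?W (p + int i) = (if i < z then Bit False else if i = z then Bit True
      else if i < z + 1 + length u then Bit (u ! (i - z - 1)) else Blank)" for i
    by (auto simp: contents_of_def nth_append nth_Cons')
  have "(c i, c (Suc i)) \<in> trans ?P" if "i < z" for i
    unfolding c_def
    by (intro transI) (use l that W[of i] in \<open>auto simp: emit_def intro!: fun_upd_idem[symmetric]\<close>)
  from relpow_chain[of z c, OF this]
  have 1: "(c 0, c z) \<in> trans ?P ^^ z" .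
  have 2: "(c z, d 0) \<in> trans ?P ^^ 1"
    unfolding relpow_1 c_def d_def
    by (intro transI) (use l \<sigma>(1) W[of z] in \<open>auto simp: emit_def blank_def intro!: fun_upd_idem[symmetric]\<close>)
  have "(d i, d (Suc i)) \<in> trans ?P" if "i < length u" for i
  proof -
    have "(contents_of (map Bit (take i u)))(int i := Bit (u ! i)) = contents_of (map Bit (take (Suc i) u))"
      using contents_of_snoc[of "map Bit (take i u)" "Bit (u ! i)"] that
      by (simp add: take_Suc_conv_app_nth)
    then show ?thesis
      unfolding d_def
      by (intro transI) (use l that W[of "z + 1 + i"] in
        \<open>auto simp: emit_def intro!: fun_upd_idem[symmetric]\<close>)
  qed
  from relpow_chain[of "length u" d, OF this]
  have 3: "(d 0, d (length u)) \<in> trans ?P ^^ length u" .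
  have 4: "(d (length u), (2, snd (d (length u)))) \<in> trans ?P ^^ 1"
    unfolding relpow_1 d_def
    by (intro transI) (use l W[of "z + 1 + length u"] in
      \<open>auto simp: emit_def intro!: fun_upd_idem[symmetric]\<close>)
  have "c 0 = (0, \<sigma>)"
    using \<sigma>(2) by (auto simp: c_def fun_eq_iff)
  with relpow_trans[OF 1 relpow_trans[OF 2 relpow_trans[OF 3 4]]]
  have "runs ?P \<sigma> (z + 2 + length u) (snd (d (length u)))"
    unfolding runs_def by (simp add: emit_def add.assoc)
  then show ?thesis
    by (intro exI[of _ "snd (d (length u))"]) (simp add: d_def)
qed

section \<open>Combining polynomial-time functions\<close>

lemma poly_mono_nat: "x \<le> y \<Longrightarrow> poly p x \<le> poly p y" for p :: "nat poly"
  by (induction p) (auto intro: add_mono mult_mono)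

lemma wf_prog_mono: "wf_prog K S P \<Longrightarrow> K \<le> K' \<Longrightarrow> wf_prog K' S P"
  unfolding wf_prog_def by (meson order.trans)

text \<open>\<open>K\<close> tapes are taken and everything after them is blank, so words can be
  prepared one after another on fresh tapes. Well-formedness over every larger alphabet allows the
  alphabets of the single programs to be united.\<close>

definition appends :: "nat \<Rightarrow> prog \<Rightarrow> nat \<Rightarrow> sym set \<Rightarrow> nat \<Rightarrow> nat poly \<Rightarrow> (str \<Rightarrow> sym list) \<Rightarrow> bool" where
  "appends K Q K' S j p w \<longleftrightarrow>
     K \<le> j \<and> j < K' \<and> finite S \<and> (\<forall>S'. S \<subseteq> S' \<longrightarrow> wf_prog K' S' Q) \<and>
     (\<forall>x \<sigma>. \<sigma> 0 = init_store x 0 \<longrightarrow> (\<forall>i\<ge>K. \<sigma> i = blank) \<longrightarrow>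
       (\<exists>t \<sigma>'. t \<le> poly p (length x) \<and> runs Q \<sigma> t \<sigma>' \<and> \<sigma>' j = word_tape (w x) \<and>
         (\<forall>i<K. \<sigma>' i = \<sigma> i) \<and> (\<forall>i\<ge>K'. \<sigma>' i = blank)))"

lemma appendsD:
  assumes "appends K Q K' S j p w" and "\<sigma> 0 = init_store x 0" and "\<forall>i\<ge>K. \<sigma> i = blank"
  shows "\<exists>t \<sigma>'. t \<le> poly p (length x) \<and> runs Q \<sigma> t \<sigma>' \<and> \<sigma>' j = word_tape (w x) \<and>
    (\<forall>i<K. \<sigma>' i = \<sigma> i) \<and> (\<forall>i\<ge>K'. \<sigma>' i = blank)"
  using assms unfolding appends_def by simp

text \<open>\<open>K\<close> starts at 2 because tapes 0 and 1 are reserved for the input and the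
  final output.\<close>

definition loadable :: "(str \<Rightarrow> sym list) \<Rightarrow> bool" where
  "loadable w \<longleftrightarrow>
     (\<exists>p. \<forall>x. Blank \<notin> set (w x) \<and> length (w x) \<le> poly p (length x)) \<and>
     (\<forall>K\<ge>2. \<exists>Q K' S j p. appends K Q K' S j p w)"

definition loads :: "prog \<Rightarrow> nat \<Rightarrow> sym set \<Rightarrow> nat list \<Rightarrow> nat poly \<Rightarrow> (str \<Rightarrow> sym list) list \<Rightarrow> bool" where
  "loads P K S js p ws \<longleftrightarrow>
     K \<ge> 2 \<and> finite S \<and> base \<subseteq> S \<and> (\<forall>S'. S \<subseteq> S' \<longrightarrow> wf_prog K S' P) \<and>
     length js = length ws \<and> (\<forall>j\<in>set js. 2 \<le> j \<and> j < K) \<and>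
     (\<forall>x. (\<forall>w\<in>set ws. Blank \<notin> set (w x) \<and> length (w x) \<le> poly p (length x)) \<and>
       (\<exists>t \<sigma>. t \<le> poly p (length x) \<and> runs P (init_store x) t \<sigma> \<and>
         \<sigma> 0 = init_store x 0 \<and> \<sigma> 1 = blank \<and> (\<forall>i\<ge>K. \<sigma> i = blank) \<and>
         (\<forall>i<length js. \<sigma> (js ! i) = word_tape ((ws ! i) x))))"

text \<open>A program without states starts in its exit state, so its transition function is never
  consulted.\<close>

lemma loads_Nil: "loads (0, undefined) 2 base [] 0 []"
  by (auto simp: loads_def wf_prog_def runs_def base_def init_store_def)

lemma loads_snoc:
  assumes ws: "loads P K S js p ws" and w: "loadable w"
  shows "\<exists>P K S js p. loads P K S js p (ws @ [w])"
proof -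
  have K: "K \<ge> 2" and js: "length js = length ws" "\<forall>j\<in>set js. 2 \<le> j \<and> j < K"
    using ws unfolding loads_def by auto
  obtain p1 where p1: "\<And>x. Blank \<notin> set (w x) \<and> length (w x) \<le> poly p1 (length x)"
    using w unfolding loadable_def by blast
  from w K obtain Q K' S1 j p2 where Q: "appends K Q K' S1 j p2 w"
    unfolding loadable_def by blast
  then have j: "K \<le> j" "j < K'" and S1: "finite S1" "\<forall>S'. S1 \<subseteq> S' \<longrightarrow> wf_prog K' S' Q"
    unfolding appends_def by blast+
  let ?p = "p + p1 + p2"
  have "(\<forall>u\<in>set (ws @ [w]). Blank \<notin> set (u x) \<and> length (u x) \<le> poly ?p (length x)) \<and>
      (\<exists>t \<sigma>. t \<le> poly ?p (length x) \<and> runs (seq P Q) (init_store x) t \<sigma> \<and>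
         \<sigma> 0 = init_store x 0 \<and> \<sigma> 1 = blank \<and> (\<forall>i\<ge>K'. \<sigma> i = blank) \<and>
         (\<forall>i<length (js @ [j]). \<sigma> ((js @ [j]) ! i) = word_tape (((ws @ [w]) ! i) x)))" for x
  proof
    have "\<forall>u\<in>set ws. Blank \<notin> set (u x) \<and> length (u x) \<le> poly p (length x)"
      using ws unfolding loads_def by blast
    then show "\<forall>u\<in>set (ws @ [w]). Blank \<notin> set (u x) \<and> length (u x) \<le> poly ?p (length x)"
      using p1[of x] by fastforce
    obtain t \<sigma> where 1: "t \<le> poly p (length x)" "runs P (init_store x) t \<sigma>"
      "\<sigma> 0 = init_store x 0" "\<sigma> 1 = blank" "\<forall>i\<ge>K. \<sigma> i = blank"
      "\<forall>i<length js. \<sigma> (js ! i) = word_tape ((ws ! i) x)"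
      using ws unfolding loads_def by blast
    obtain t' \<sigma>' where 2: "t' \<le> poly p2 (length x)" "runs Q \<sigma> t' \<sigma>'" "\<sigma>' j = word_tape (w x)"
      "\<forall>i<K. \<sigma>' i = \<sigma> i" "\<forall>i\<ge>K'. \<sigma>' i = blank"
      using appendsD[OF Q 1(3,5)] by blast
    have "\<sigma>' ((js @ [j]) ! i) = word_tape (((ws @ [w]) ! i) x)" if "i < length (js @ [j])" for i
      using that 1(6) 2(3,4) js by (cases "i < length js") (auto simp: nth_append less_Suc_eq)
    with 1 2 K runs_seq[OF 1(2) 2(2)]
    show "\<exists>t \<sigma>. t \<le> poly ?p (length x) \<and> runs (seq P Q) (init_store x) t \<sigma> \<and>
         \<sigma> 0 = init_store x 0 \<and> \<sigma> 1 = blank \<and> (\<forall>i\<ge>K'. \<sigma> i = blank) \<and>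
         (\<forall>i<length (js @ [j]). \<sigma> ((js @ [j]) ! i) = word_tape (((ws @ [w]) ! i) x))"
      by (intro exI[of _ "t + t'"] exI[of _ \<sigma>']) auto
  qed
  moreover have "wf_prog K' S' (seq P Q)" if "S \<union> S1 \<subseteq> S'" for S'
  proof (rule wf_prog_seq)
    have "wf_prog K S' P" using ws that unfolding loads_def by simp
    then show "wf_prog K' S' P" using j by (intro wf_prog_mono[of K S' P K']) auto
    show "wf_prog K' S' Q" using S1(2) that by simp
  qed
  ultimately have "loads (seq P Q) K' (S \<union> S1) (js @ [j]) ?p (ws @ [w])"
    using ws S1(1) j unfolding loads_def by fastforce
  then show ?thesis by blast
qed

lemma loadable_loads: "\<forall>w\<in>set ws. loadable w \<Longrightarrow> \<exists>P K S js p. loads P K S js p ws"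
proof (induction ws rule: rev_induct)
  case Nil
  show ?case using loads_Nil by blast
next
  case (snoc w ws)
  then show ?case using loads_snoc by fastforce
qed

lemma length_adapt: "length (adapt del v w) \<le> length w + 1"
  by (auto simp: adapt_def)

lemma loadable_input:
  assumes u: "\<And>x. u x = adapt del v (map Bit x)" and v: "v = Blank \<or> v \<in> base \<and> \<not> del"
  shows "loadable u"
  unfolding loadable_def
proof (intro conjI allI impI)
  have Blank: "Blank \<notin> set (u x)" for x
    using v by (auto simp: u adapt_def dest: in_set_butlastD)
  then have "Blank \<notin> set (u x) \<and> length (u x) \<le> poly [:1, 1:] (length x)" for x
    using length_adapt[of del v "map Bit x"] by (simp add: u)
  then show "\<exists>p. \<forall>x. Blank \<notin> set (u x) \<and> length (u x) \<le> poly p (length x)" by blast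
  fix K :: nat
  assume K: "K \<ge> 2"
  let ?Q = "seq (copy K del v) (mark K)"
  have "\<exists>t \<sigma>'. t \<le> poly [:7, 3:] (length x) \<and> runs ?Q \<sigma> t \<sigma>' \<and> \<sigma>' K = word_tape (u x) \<and>
      (\<forall>i<K. \<sigma>' i = \<sigma> i) \<and> (\<forall>i\<ge>K + 1. \<sigma>' i = blank)"
    if \<sigma>: "\<sigma> 0 = init_store x 0" "\<forall>i\<ge>K. \<sigma> i = blank" for x \<sigma>
  proof -
    have 1: "runs (copy K del v) \<sigma> (2 * length (map Bit x) + 3) (\<sigma>(K := (contents_of (u x), 0)))"
      unfolding u using K \<sigma> v by (intro runs_copy) (auto simp: init_store_def)
    have 2: "runs (mark K) (\<sigma>(K := (contents_of (u x), 0))) (length (u x) + 3)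
        ((\<sigma>(K := (contents_of (u x), 0)))(K := word_tape (u x)))"
      using Blank by (intro runs_mark) auto
    show ?thesis
      using runs_seq[OF 1 2] \<sigma>(2) length_adapt[of del v "map Bit x"]
      by (intro exI[of _ "2 * length (map Bit x) + 3 + (length (u x) + 3)"]
          exI[of _ "(\<sigma>(K := (contents_of (u x), 0)))(K := word_tape (u x))"]) (auto simp: u)
  qed
  moreover have "wf_prog (K + 1) S' ?Q" if "base \<subseteq> S'" for S'
    using that v by (intro wf_prog_seq wf_prog_copy wf_prog_mark) (auto simp: base_def)
  ultimately have "appends K ?Q (K + 1) base K [:7, 3:] u"
    by (simp add: appends_def base_def)
  then show "\<exists>Q K' S j p. appends K Q K' S j p u" by blast
qed

lemma loadable_compose:
  assumes f: "polytime_computable f"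
    and g: "\<And>x. map Bit (g x) = adapt del v (map Bit x)" and v: "v = Blank \<or> v \<in> base \<and> \<not> del"
    and bound: "\<And>z. Blank \<notin> set (f z) \<and> length (f z) \<le> length z + 1"
  shows "loadable (\<lambda>x. f (g x))"
  unfolding loadable_def
proof (intro conjI allI impI)
  have g_len: "length (g x) \<le> length x + 1" for x
    using length_adapt[of del v "map Bit x"] by (simp flip: g)
  have fg_len: "length (f (g x)) \<le> length x + 2" for x
    using bound[of "g x"] g_len[of x] by linarith
  then have "Blank \<notin> set (f (g x)) \<and> length (f (g x)) \<le> poly [:2, 1:] (length x)" for x
    using bound[of "g x"] fg_len[of x] by simp
  then show "\<exists>p. \<forall>x. Blank \<notin> set (f (g x)) \<and> length (f (g x)) \<le> poly p (length x)" by blast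
  obtain M pM where M: "wf_tm M" "computes_within M f (poly pM)"
    using f unfolding polytime_computable_def by blast
  define n where "n = num_tapes M"
  have n: "n \<ge> 2" using M(1) by (simp add: wf_tm_def n_def)
  fix K :: nat
  assume K: "K \<ge> 2"
  let ?Q = "seq (copy K del v) (seq (embed M K) (seq (unwind (K + 1) (K + n)) (mark (K + 1))))"
  \<comment> \<open>For \<open>n = length x\<close>: \<open>2 * n + 3\<close> steps of
    \<open>copy\<close>, \<open>t\<close> of the machine, \<open>t + 2\<close> of
    \<open>unwind\<close> and at most \<open>n + 5\<close> of \<open>mark\<close>, where
    \<open>t\<close> is at most \<open>poly pM (n + 1)\<close>.\<close>
  let ?p = "[:10, 3:] + smult 2 (pcompose pM [:1, 1:])"
  have "\<exists>t \<sigma>'. t \<le> poly ?p (length x) \<and> runs ?Q \<sigma> t \<sigma>' \<and> \<sigma>' (K + 1) = word_tape (f (g x)) \<and>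
      (\<forall>i<K. \<sigma>' i = \<sigma> i) \<and> (\<forall>i\<ge>K + n + 1. \<sigma>' i = blank)"
    if \<sigma>: "\<sigma> 0 = init_store x 0" "\<forall>i\<ge>K. \<sigma> i = blank" for x \<sigma>
  proof -
    let ?\<sigma>1 = "\<sigma>(K := (contents_of (map Bit (g x)), 0))"
    have 1: "runs (copy K del v) \<sigma> (2 * length (map Bit x) + 3) ?\<sigma>1"
      unfolding g using K \<sigma> v by (intro runs_copy) (auto simp: init_store_def)
    have \<sigma>1: "?\<sigma>1 K = (contents_of (map Bit (g x)), 0)"
      "\<And>j. 0 < j \<Longrightarrow> j \<le> num_tapes M \<Longrightarrow> ?\<sigma>1 (K + j) = blank"
      using \<sigma> by auto
    obtain t \<sigma>2 ds where 2: "t \<le> poly pM (length (g x))" "runs (embed M K) ?\<sigma>1 t \<sigma>2" "length ds = t"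
      "\<sigma>2 (K + 1) = (contents_of (f (g x)), sum_list (map offset ds))"
      "\<sigma>2 (K + n) = (contents_of (map log_sym ds), int (length ds))"
      "\<forall>i. i < K \<or> i > K + n \<longrightarrow> \<sigma>2 i = ?\<sigma>1 i"
      using runs_embed[OF M \<sigma>1] unfolding n_def by blast
    obtain \<sigma>3 where 3: "runs (unwind (K + 1) (K + n)) \<sigma>2 (length ds + 2) \<sigma>3"
      "\<sigma>3 (K + 1) = (contents_of (f (g x)), 0)"
      "\<forall>i. i \<noteq> K + 1 \<longrightarrow> i \<noteq> K + n \<longrightarrow> \<sigma>3 i = \<sigma>2 i"
      using runs_unwind[of "K + 1" "K + n" \<sigma>2 ds, OF _ 2(5,4)] n by auto
    let ?\<sigma>4 = "\<sigma>3(K + 1 := word_tape (f (g x)))"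
    have 4: "runs (mark (K + 1)) \<sigma>3 (length (f (g x)) + 3) ?\<sigma>4"
      using bound 3(2) by (intro runs_mark) auto
    have "poly pM (length (g x)) \<le> poly pM (1 + length x)"
      using g_len[of x] by (intro poly_mono_nat) simp
    then have "2 * length (map Bit x) + 3 + (t + (length ds + 2 + (length (f (g x)) + 3))) \<le> poly ?p (length x)"
      using 2(1,3) fg_len[of x] by (simp add: poly_pcompose)
    moreover have "runs ?Q \<sigma> (2 * length (map Bit x) + 3 + (t + (length ds + 2 + (length (f (g x)) + 3)))) ?\<sigma>4"
      by (rule runs_seq[OF 1 runs_seq[OF 2(2) runs_seq[OF 3(1) 4]]])
    moreover have "(\<forall>i<K. ?\<sigma>4 i = \<sigma> i) \<and> (\<forall>i\<ge>K + n + 1. ?\<sigma>4 i = blank)"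
      using 3(3) 2(6) \<sigma>(2) n by simp
    ultimately show ?thesis by (meson fun_upd_same)
  qed
  moreover have "wf_prog (K + n + 1) S' ?Q" if "base \<union> alphabet M \<subseteq> S'" for S'
    using that v n
    by (intro wf_prog_seq wf_prog_copy wf_prog_mark wf_prog_embed wf_prog_unwind)
      (auto simp: base_def n_def)
  moreover have "finite (base \<union> alphabet M)"
    using M(1) by (simp add: base_def wf_tm_def)
  ultimately have "appends K ?Q (K + n + 1) (base \<union> alphabet M) (K + 1) ?p (\<lambda>x. f (g x))"
    using n by (simp add: appends_def)
  then show "\<exists>Q K' S j p. appends K Q K' S j p (\<lambda>x. f (g x))" by blast
qed

lemma str_of_nat_dyadic: "str_of_nat (dyadic u) = u"
proof -
  have "nat_of_str = dyadic" by (rule ext) (rule nat_of_str_eq_dyadic)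
  then show ?thesis
    unfolding str_of_nat_def using bij_is_inj[OF bij_dyadic] by simp
qed

text \<open>\<open>sel\<close> sees only the symbols under the heads when the adder starts, and
  finiteness of \<open>F\<close> bounds coefficients and carries. The \<open>+ 1\<close> on the left
  is the shift between a string and its numeral.\<close>

lemma polytime_computable_linear_combination:
  assumes ws: "\<forall>w\<in>set ws. loadable w"
    and F: "finite F" "\<And>ss p. sel ss = Some p \<Longrightarrow> p \<in> F"
    and None: "\<And>x. sel (map (\<lambda>w. last (Aux 0 # w x)) ws) = None \<Longrightarrow> h x = None"
    and Some: "\<And>x cs c. sel (map (\<lambda>w. last (Aux 0 # w x)) ws) = Some (cs, c) \<Longrightarrow>
      \<exists>n. h x = Some n \<and> int n + 1 = (\<Sum>i<length ws. cs ! i * word_val ((ws ! i) x)) + c"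
  shows "polytime_computable (\<lambda>x. encode_answer (h x))"
proof -
  obtain P K S js p where loads: "loads P K S js p ws"
    using loadable_loads[OF ws] by blast
  then have K: "K \<ge> 2" and S: "finite S" "base \<subseteq> S" "wf_prog K S P"
    and js: "length ws = length js" "\<forall>j\<in>set js. 2 \<le> j \<and> j < K"
    unfolding loads_def by auto
  let ?k = "length js"
  \<comment> \<open>A crude common bound for the constants and for the sums of absolute coefficients
    over all choices in \<open>F\<close>.\<close>
  define m where "m = (\<Sum>(cs, c)\<in>F. nat \<bar>c\<bar> + (\<Sum>i<?k. nat \<bar>cs ! i\<bar>))"
  have m: "\<bar>c\<bar> \<le> int m" "(\<Sum>i<?k. \<bar>cs ! i\<bar>) \<le> int m" if "(cs, c) \<in> F" for cs c
  proof -
    have "nat \<bar>c\<bar> + (\<Sum>i<?k. nat \<bar>cs ! i\<bar>) \<le> m"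
      unfolding m_def using member_le_sum[OF that, of "\<lambda>(cs, c). nat \<bar>c\<bar> + (\<Sum>i<?k. nat \<bar>cs ! i\<bar>)"] F(1)
      by simp
    then have "\<bar>c\<bar> + (\<Sum>i<?k. \<bar>cs ! i\<bar>) \<le> int m"
      by (simp add: of_nat_le_iff[where 'a = int, symmetric])
    moreover have "(\<Sum>i<?k. \<bar>cs ! i\<bar>) \<ge> 0" by (simp add: sum_nonneg)
    ultimately show "\<bar>c\<bar> \<le> int m" "(\<Sum>i<?k. \<bar>cs ! i\<bar>) \<le> int m" by linarith+
  qed
  \<comment> \<open>The codes of all pairs of coefficients and carry that can occur;
    \<open>N\<close> is taken above them.\<close>
  let ?N = "(\<lambda>p. Suc (to_nat p)) ` (fst ` F \<times> {- int m..int m})"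
  have "finite ?N" using F(1) by blast
  then obtain N where "\<forall>q\<in>?N. q < N"
    using finite_nat_set_iff_bounded by blast
  then have N: "Suc (to_nat (cs, C)) < Suc N" if "(cs, c) \<in> F" "\<bar>C\<bar> \<le> int m" for cs c C
  proof -
    have "(cs, C) \<in> fst ` F \<times> {- int m..int m}"
      using that by (auto simp: abs_le_iff intro: rev_image_eqI)
    then show ?thesis
      using \<open>\<forall>q\<in>?N. q < N\<close> by (meson imageI less_SucI)
  qed
  let ?A = "adder sel (Suc N) js K"
  let ?Q = "seq P (seq ?A (emit K))"
  let ?p = "smult 3 p + [:2 * m + 7:]"
  have wf: "wf_prog (K + 1) S ?Q"
    using S(2) K js
    by (intro wf_prog_seq wf_prog_mono[OF S(3)] wf_prog_adder wf_prog_emit) (auto intro: less_SucI)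
  have "\<exists>t\<le>poly ?p (length x). \<exists>\<sigma>. runs ?Q (init_store x) t \<sigma> \<and>
      fst (\<sigma> 1) = contents_of (encode_answer (h x))" for x
  proof -
    let ?ws = "map (\<lambda>w. w x) ws" and ?L = "poly p (length x)"
    obtain t \<sigma> where 1: "t \<le> ?L" "runs P (init_store x) t \<sigma>"
      "\<sigma> 1 = blank" "\<forall>i\<ge>K. \<sigma> i = blank" "\<forall>i<?k. \<sigma> (js ! i) = word_tape ((ws ! i) x)"
      using loads unfolding loads_def by blast
    have Blank: "\<And>w. w \<in> set ?ws \<Longrightarrow> Blank \<notin> set w \<and> length w \<le> ?L"
      using loads unfolding loads_def by auto
    have rd: "map (\<lambda>j. read_tape (\<sigma> j)) js = map (\<lambda>w. last (Aux 0 # w x)) ws"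
      using js(1) 1(5) by (intro nth_equalityI) (auto simp: read_word_tape)
    have l: "K \<notin> set js" "1 \<notin> set js" "K \<noteq> 1" using js(2) K by auto
    show ?thesis
    proof (cases "sel (map (\<lambda>j. read_tape (\<sigma> j)) js)")
      case sel: None
      let ?\<sigma>2 = "\<sigma>(K := (contents_of [NotInSet], 0))"
      let ?\<sigma>3 = "?\<sigma>2(1 := (contents_of [NotInSet], 0))"
      have 2: "runs ?A \<sigma> 1 ?\<sigma>2"
        using sel 1(4) by (intro runs_adder_None) auto
      have 3: "runs (emit K) ?\<sigma>2 1 ?\<sigma>3"
        using l 1(3) by (intro runs_emit_NotInSet) auto
      have "h x = None" using None sel by (simp add: rd)
      with 1(1) runs_seq[OF 1(2) runs_seq[OF 2 3]] show ?thesis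
        by (intro exI[of _ "t + (1 + 1)"] conjI exI[of _ ?\<sigma>3]) auto
    next
      case sel: (Some cc)
      obtain cs c where cc: "cc = (cs, c)" by fastforce
      have inF: "(cs, c) \<in> F" using F(2) sel cc by blast
      obtain r where r: "h x = Some r" "int r + 1 = (\<Sum>i<length ws. cs ! i * word_val ((ws ! i) x)) + c"
        using Some[OF sel[unfolded rd cc]] by blast
      let ?H = "int r + 1"
      have H: "?H = (\<Sum>i<?k. cs ! i * word_val (?ws ! i)) + c" "?H \<ge> 1"
        using r(2) js(1) by simp_all
      have len: "length ?ws = ?k" and \<sigma>_K: "\<sigma> K = blank"
        and \<sigma>_js: "\<And>i. i < ?k \<Longrightarrow> \<sigma> (js ! i) = word_tape (?ws ! i)"
        using js(1) 1(4,5) by simp_all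
      obtain n \<sigma>2 where 2: "n \<le> ?L + 1 + m" "?H < 2 ^ n" "runs ?A \<sigma> (n + 2) \<sigma>2"
        "\<sigma>2 K = (\<lambda>i. contents_of (map Bit (bits ?H n)) (i - (1 - int n)), 1 - int n)"
        "\<forall>i. i \<noteq> K \<longrightarrow> i \<notin> set js \<longrightarrow> \<sigma>2 i = \<sigma> i"
        using runs_adder_Some[where ws = ?ws and L = ?L and \<sigma> = \<sigma> and js = js and sel = sel,
            OF sel[unfolded cc] len \<sigma>_js \<sigma>_K l(1) Blank m[OF inF] N[OF inF] H]
        by blast
      obtain z u where u: "bits ?H n = replicate z False @ True # u" "int (dyadic u) + 1 = ?H"
        using bits_strip[OF H(2) 2(2)] by blast
      have "\<sigma>2 1 = blank" using 2(5) l 1(3) by auto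
      from runs_emit[OF l(3) this 2(4)[unfolded u(1)]]
      obtain \<sigma>3 where 3: "runs (emit K) \<sigma>2 (z + 2 + length u) \<sigma>3" "fst (\<sigma>3 1) = contents_of (map Bit u)"
        by blast
      have "length (bits ?H n) = n" by (simp add: bits_def)
      then have "z + 2 + length u = n + 1" unfolding u(1) by simp
      then have "t + (n + 2 + (z + 2 + length u)) \<le> poly ?p (length x)"
        using 1(1) 2(1) by simp
      moreover have "encode_answer (h x) = map Bit u"
        using str_of_nat_dyadic[of u] u(2) r(1) by simp
      ultimately show ?thesis
        using runs_seq[OF 1(2) runs_seq[OF 2(3) 3(1)]] 3(2) by metis
    qed
  qed
  then show ?thesis
    using K by (intro polytime_computable_progI[OF wf S(1,2)]) simp
qed

section \<open>Ranks\<close>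

lemma rank_eq_card: "rank A y = card {z \<in> A. dyadic z \<le> dyadic y}"
proof -
  have "llex_le z y \<longleftrightarrow> dyadic z \<le> dyadic y" for z
    using bij_is_inj[OF bij_dyadic] by (auto simp: llex_le_def llex_less_iff_dyadic le_less dest: injD)
  then show ?thesis by (simp add: rank_def conj_commute)
qed

lemma finite_dyadic_le [simp]: "finite {z. dyadic z \<le> n}" "finite {z \<in> A. dyadic z \<le> n}"
  and card_dyadic_le: "card {z. dyadic z \<le> n} = n + 1"
proof -
  have inj: "inj dyadic" by (rule bij_is_inj[OF bij_dyadic])
  have "{z. dyadic z \<le> n} = dyadic -` {..n}" by auto
  then show fin: "finite {z. dyadic z \<le> n}" and "card {z. dyadic z \<le> n} = n + 1"
    using inj bij_is_surj[OF bij_dyadic] by (simp_all add: finite_vimageI card_vimage_inj)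
  show "finite {z \<in> A. dyadic z \<le> n}"
    by (rule finite_subset[OF _ fin]) auto
qed

lemma rank_UNIV: "rank UNIV y = dyadic y + 1"
  by (simp add: rank_eq_card card_dyadic_le)

lemma rank_Compl: "rank A y + rank (- A) y = dyadic y + 1"
proof -
  have "{z. dyadic z \<le> dyadic y} = {z \<in> A. dyadic z \<le> dyadic y} \<union> {z \<in> - A. dyadic z \<le> dyadic y}"
    by auto
  then have "card {z. dyadic z \<le> dyadic y} = rank A y + rank (- A) y"
    unfolding rank_eq_card by (simp only:) (subst card_Un_disjoint, auto)
  then show ?thesis by (simp add: card_dyadic_le)
qed

lemma snoc_in_join [simp]: "x @ [False] \<in> join A B \<longleftrightarrow> x \<in> A" "x @ [True] \<in> join A B \<longleftrightarrow> x \<in> B"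
  "[] \<notin> join A B"
  by (auto simp: join_def)

text \<open>\<open>x @ [False]\<close> and \<open>x @ [True]\<close> are neighbours in the order, so
  up to \<open>x @ [True]\<close> both halves are counted up to \<open>x\<close>. Stopping at
  \<open>x @ [False]\<close> loses just \<open>x @ [True]\<close>, which counts only if
  \<open>x \<in> B\<close>.\<close>

lemma rank_join_True: "rank (join A B) (x @ [True]) = rank A x + rank B x"
  and rank_join_False: "rank (join A B) (x @ [False]) + (if x \<in> B then 1 else 0) = rank A x + rank B x"
proof -
  let ?S = "\<lambda>A. {z \<in> A. dyadic z \<le> dyadic x}"
  have card: "card ((\<lambda>z. z @ [False]) ` S \<union> (\<lambda>z. z @ [True]) ` T) = card S + card T"
    if "finite S" "finite T" for S T :: "str set"
    using that by (subst card_Un_disjoint) (auto simp: card_image inj_on_def)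
  have "{w \<in> join A B. dyadic w \<le> dyadic (x @ [True])} =
      (\<lambda>z. z @ [False]) ` ?S A \<union> (\<lambda>z. z @ [True]) ` ?S B" (is "?L = ?R")
  proof (rule set_eqI)
    show "w \<in> ?L \<longleftrightarrow> w \<in> ?R" for w
      by (cases w rule: rev_cases; cases "last w") auto
  qed
  then show "rank (join A B) (x @ [True]) = rank A x + rank B x"
    unfolding rank_eq_card by (simp only: card finite_dyadic_le)
  \<comment> \<open>By parity the left side says \<open>dyadic z < dyadic x\<close>; this form
    matches the removal of the single element \<open>x\<close>.\<close>
  have le: "2 * dyadic z + 2 \<le> 2 * dyadic x + 1 \<longleftrightarrow> dyadic z \<le> dyadic x \<and> z \<noteq> x" for z
    using inj_eq[OF bij_is_inj[OF bij_dyadic], of z x] by linarith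
  have "{w \<in> join A B. dyadic w \<le> dyadic (x @ [False])} =
      (\<lambda>z. z @ [False]) ` ?S A \<union> (\<lambda>z. z @ [True]) ` (?S B - {x})" (is "?L = ?R")
  proof (rule set_eqI)
    show "w \<in> ?L \<longleftrightarrow> w \<in> ?R" for w
      using le[of "butlast w"] by (cases w rule: rev_cases; cases "last w") auto
  qed
  then have "rank (join A B) (x @ [False]) = card (?S A) + card (?S B - {x})"
    unfolding rank_eq_card by (simp only: card finite_dyadic_le finite_Diff)
  moreover have "card (?S B - {x}) + (if x \<in> B then 1 else 0) = card (?S B)"
  proof (cases "x \<in> B")
    case True
    then have "x \<in> ?S B" by simp
    then show ?thesis using True card_Suc_Diff1[OF finite_dyadic_le(2) \<open>x \<in> ?S B\<close>] by simp
  qed simp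
  ultimately show "rank (join A B) (x @ [False]) + (if x \<in> B then 1 else 0) = rank A x + rank B x"
    unfolding rank_eq_card by simp
qed

section \<open>Rankable sets and the two closure properties\<close>

definition rank_answer :: "str set \<Rightarrow> str \<Rightarrow> nat option" where
  "rank_answer A x = (if x \<in> A then Some (rank A x) else None)"

lemma semistrong_P_rankable_iff:
  "semistrong_P_rankable A \<longleftrightarrow> polytime_computable (\<lambda>x. encode_answer (rank_answer A x))"
proof -
  have "(\<forall>x. x \<in> A \<longrightarrow> f x = Some (rank A x)) \<and> (\<forall>x. x \<notin> A \<longrightarrow> f x = None) \<longleftrightarrow>
      f = rank_answer A" for f
    by (auto simp: rank_answer_def fun_eq_iff)
  then show ?thesis by (simp add: semistrong_P_rankable_def)
qed

lemma encode_answer_Some: "\<exists>u. encode_answer (Some n) = map Bit u \<and> dyadic u = n"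
  using bij_is_surj[OF bij_dyadic] by (metis encode_answer.simps(2) str_of_nat_dyadic surjD)

lemma word_val_encode_answer: "word_val (encode_answer (Some n)) = int n + 1"
proof -
  obtain u where "encode_answer (Some n) = map Bit u" "dyadic u = n"
    using encode_answer_Some by blast
  then show ?thesis by (simp only: word_val_Bits)
qed

text \<open>For the empty string the last symbol is the mark, so the test is correct for the number
  0 too.\<close>

lemma last_encode_answer: "last (Aux 0 # encode_answer a) = NotInSet \<longleftrightarrow> a = None"
proof (cases a)
  case (Some n)
  then show ?thesis using encode_answer_Some[of n] by (auto simp: last_map)
qed simp

text \<open>The rank is at most \<open>dyadic z + 1\<close>, so \<open>2 ^ length u\<close> is at
  most \<open>dyadic z + 2\<close>, which is at most \<open>2 ^ (length z + 1)\<close>.\<close>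

lemma encode_rank_answer_bound:
  "Blank \<notin> set (encode_answer (rank_answer A z)) \<and>
    length (encode_answer (rank_answer A z)) \<le> length z + 1"
proof (cases "z \<in> A")
  case True
  obtain u where u: "encode_answer (Some (rank A z)) = map Bit u" "dyadic u = rank A z"
    using encode_answer_Some by blast
  have "dyadic u \<le> dyadic z + 1"
    using u(2) rank_Compl[of A z] by linarith
  then have "(2::nat) ^ length u \<le> 2 ^ (length z + 1)"
    using dyadic_bounds[of u] dyadic_bounds[of z] by simp
  then have "length u \<le> length z + 1" by (simp only: power_increasing_iff one_less_numeral_iff semiring_norm)
  then show ?thesis using True u(1) by (auto simp: rank_answer_def)
qed (simp add: rank_answer_def)

lemma loadable_rank_answer:
  assumes "semistrong_P_rankable A"
  shows "loadable (\<lambda>x. encode_answer (rank_answer A (x @ [b])))"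
    and "loadable (\<lambda>x. encode_answer (rank_answer A (butlast x)))"
proof -
  note A = assms[unfolded semistrong_P_rankable_iff]
  show "loadable (\<lambda>x. encode_answer (rank_answer A (x @ [b])))"
    by (rule loadable_compose[OF A, of _ False "Bit b"])
      (use encode_rank_answer_bound in \<open>cases b; simp add: adapt_def base_def\<close>)+
  show "loadable (\<lambda>x. encode_answer (rank_answer A (butlast x)))"
    by (rule loadable_compose[OF A, of _ True Blank])
      (use encode_rank_answer_bound in \<open>simp_all add: adapt_def map_butlast\<close>)
qed

lemma loadable_id: "loadable (map Bit)"
  by (rule loadable_input[of _ False Blank]) (auto simp: adapt_def)

lemma loadable_butlast: "loadable (\<lambda>x. map Bit (butlast x))"
  by (rule loadable_input[of _ True Blank]) (auto simp: adapt_def map_butlast)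

lemma semistrong_P_rankable_UNIV: "semistrong_P_rankable UNIV"
  unfolding semistrong_P_rankable_iff
  by (rule polytime_computable_linear_combination[of "[map Bit]" "{([1], 1)}" "\<lambda>_. Some ([1], 1)"])
    (auto simp: loadable_id rank_answer_def rank_UNIV word_val_Bits)

lemma semistrong_P_rankable_Compl:
  assumes "semistrong_P_rankable (join A UNIV)"
  shows "semistrong_P_rankable (- A)"
proof -
  let ?w = "\<lambda>b x. encode_answer (rank_answer (join A UNIV) (x @ [b]))"
  \<comment> \<open>With \<open>r\<close> the rank of \<open>x @ [True]\<close> in the join,
    \<open>rank (- A) x = 2 * (dyadic x + 1) - r\<close>. The numeral of \<open>r\<close> is
    \<open>r + 1\<close> and that of the result again one more, whence the constant 2. The word for
    \<open>x @ [False]\<close> has coefficient 0: it tells whether \<open>x \<in> A\<close>.\<close>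
  let ?p = "([0, -1, 2], 2) :: int list \<times> int"
  let ?sel = "\<lambda>ss. if ss ! 0 = NotInSet then Some ?p else None"
  let ?ws = "[?w False, ?w True, map Bit]"
  show ?thesis
    unfolding semistrong_P_rankable_iff
  proof (rule polytime_computable_linear_combination[of ?ws "{?p}" ?sel])
    show "\<forall>w\<in>set ?ws. loadable w"
      using loadable_rank_answer(1)[OF assms] loadable_id by simp
    show "?sel ss = Some p \<Longrightarrow> p \<in> {?p}" for ss p
      by (auto split: if_splits)
    fix x
    have sel: "?sel (map (\<lambda>w. last (Aux 0 # w x)) ?ws) = (if x \<in> A then None else Some ?p)"
      by (simp only: list.map nth_Cons_0 last_encode_answer) (simp add: rank_answer_def)
    show "rank_answer (- A) x = None" if "?sel (map (\<lambda>w. last (Aux 0 # w x)) ?ws) = None"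
      using that unfolding sel by (auto simp: rank_answer_def split: if_splits)
    fix cs c
    assume "?sel (map (\<lambda>w. last (Aux 0 # w x)) ?ws) = Some (cs, c)"
    then have x: "x \<notin> A" and cs: "cs = [0, -1, 2]" "c = 2"
      unfolding sel by (auto split: if_splits)
    have "int (rank (- A) x) + 1 = (\<Sum>i<length ?ws. cs ! i * word_val ((?ws ! i) x)) + c"
      using rank_Compl[of A x]
      by (simp add: cs numeral_3_eq_3 rank_answer_def word_val_encode_answer word_val_Bits
          rank_join_True rank_UNIV del: encode_answer.simps)
    then show "\<exists>n. rank_answer (- A) x = Some n \<and>
        int n + 1 = (\<Sum>i<length ?ws. cs ! i * word_val ((?ws ! i) x)) + c"
      using x by (simp add: rank_answer_def)
  qed simp
qed

lemma semistrong_P_rankable_join: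
  assumes "semistrong_P_rankable A" "semistrong_P_rankable (- A)"
    and "semistrong_P_rankable B" "semistrong_P_rankable (- B)"
  shows "semistrong_P_rankable (join A B)"
proof -
  let ?w = "\<lambda>A x. encode_answer (rank_answer A (butlast x))"
  let ?ws = "[?w A, ?w (- A), ?w B, ?w (- B), \<lambda>x. map Bit (butlast x), map Bit]"
  \<comment> \<open>If \<open>butlast y\<close> lies in both sets, their ranks are added; otherwise
    the missing rank is replaced by \<open>dyadic (butlast y) + 1\<close> minus the rank in the
    complement. For last bit \<open>False\<close> and membership in both sets, 1 is subtracted
    because \<open>butlast y @ [True]\<close> is not reached, whence -2 instead of -1. All other
    units come from the numerals.\<close>
  let ?F = "{([1, 0, 1, 0, 0, 0], -2), ([1, 0, 0, -1, 1, 0], 1),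
    ([1, 0, 1, 0, 0, 0], -1), ([0, -1, 1, 0, 1, 0], 1)} :: (int list \<times> int) set"
  \<comment> \<open>Entry 5 shows the last bit of the input, or the mark if the input is empty; then
    neither test succeeds and the answer is \<open>None\<close>, as it should be.\<close>
  let ?sel = "\<lambda>ss.
    if ss ! 5 = Bit False \<and> ss ! 0 \<noteq> NotInSet then
      Some (if ss ! 2 \<noteq> NotInSet then ([1, 0, 1, 0, 0, 0], -2) else ([1, 0, 0, -1, 1, 0], 1)
        :: int list \<times> int)
    else if ss ! 5 = Bit True \<and> ss ! 2 \<noteq> NotInSet then
      Some (if ss ! 0 \<noteq> NotInSet then ([1, 0, 1, 0, 0, 0], -1) else ([0, -1, 1, 0, 1, 0], 1))
    else None"
  show ?thesis
    unfolding semistrong_P_rankable_iff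
  proof (rule polytime_computable_linear_combination[of ?ws ?F ?sel])
    show "\<forall>w\<in>set ?ws. loadable w"
      using assms loadable_rank_answer(2) loadable_id loadable_butlast by simp
    show "?sel ss = Some p \<Longrightarrow> p \<in> ?F" for ss p
      by (auto split: if_splits)
    fix y
    let ?ss = "map (\<lambda>w. last (Aux 0 # w y)) ?ws"
    have "?ss ! 0 = NotInSet \<longleftrightarrow> butlast y \<notin> A" "?ss ! 2 = NotInSet \<longleftrightarrow> butlast y \<notin> B"
      "?ss ! 5 = last (Aux 0 # map Bit y)"
      by (simp_all add: last_encode_answer rank_answer_def del: last.simps)
    then have sel: "?sel ?ss =
      (if last (Aux 0 # map Bit y) = Bit False \<and> butlast y \<in> A then
        Some (if butlast y \<in> B then ([1, 0, 1, 0, 0, 0], -2) else ([1, 0, 0, -1, 1, 0], 1)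
          :: int list \<times> int)
      else if last (Aux 0 # map Bit y) = Bit True \<and> butlast y \<in> B then
        Some (if butlast y \<in> A then ([1, 0, 1, 0, 0, 0], -1) else ([0, -1, 1, 0, 1, 0], 1))
      else None)"
      by (simp only: not_not)
    show "rank_answer (join A B) y = None" if "?sel ?ss = None"
      using that unfolding sel
      by (cases y rule: rev_cases; cases "last y") (auto simp: rank_answer_def split: if_splits)
    fix cs c
    assume cc: "?sel ?ss = Some (cs, c)"
    note cc = cc[unfolded sel]
    then obtain x b where y: "y = x @ [b]"
      by (cases y rule: rev_cases) auto
    have in_join: "y \<in> join A B"
      using cc unfolding y by (cases b) (auto split: if_splits)
    have Compl: "int (rank A x) = int (dyadic x) + 1 - int (rank (- A) x)"
      "int (rank B x) = int (dyadic x) + 1 - int (rank (- B) x)"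
      using rank_Compl[of A x] rank_Compl[of B x] by linarith+
    have "int (rank (join A B) y) + 1 = (\<Sum>i<length ?ws. cs ! i * word_val ((?ws ! i) y)) + c"
      using cc rank_join_False[of A B x] Compl unfolding y
      by (cases b)
        (auto simp: numeral_eq_Suc rank_answer_def word_val_encode_answer word_val_Bits
          rank_join_True simp del: encode_answer.simps split: if_splits)
    then show "\<exists>n. rank_answer (join A B) y = Some n \<and>
        int n + 1 = (\<Sum>i<length ?ws. cs ! i * word_val ((?ws ! i) y)) + c"
      using in_join by (simp add: rank_answer_def)
  qed simp
qed

theorem theorem29:
  shows "closed_under_complementation {A. semistrong_P_rankable A} \<longleftrightarrow>
         closed_under_join {A. semistrong_P_rankable A}"
  using semistrong_P_rankable_Compl semistrong_P_rankable_join semistrong_P_rankable_UNIV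
  unfolding closed_under_complementation_def closed_under_join_def by blast

end
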